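(* Let $q\in\mathbb{R}\setminus\{0\}$, $\alpha,\beta\in\mathbb{R}$, and take $\gamma=q^2$, $\epsilon=q^{-4}$ in the definition of $\delta$ on 2-forms of the quantum sphere $S^2_q$; let $\Delta=\delta\,\mathrm{d}+\mathrm{d}\,\delta$. Then for all $f\in S^2_q$ $$\Delta(f\,e^+\wedge e^-)=(\Delta f)\,e^+\wedge e^- .$$ Thus the eigenvalues of $\Delta$ on 2-forms are the same as those on 0-forms, and the corresponding eigen-2-forms are $e^+\wedge e^-$ times the 0-form eigenfunctions.
   Context: $\mathbb{C}_q[SL_2]$ is the unital associative $\mathbb{C}$-algebra with generators $a,b,c,d$ and relations $ba=qab$, $ca=qac$, $db=qbd$, $dc=qcd$, $cb=bc$, $da-ad=q(1-q^{-2})bc$, $ad-q^{-1}bc=1$. It is $\mathbb{Z}$-graded with $a,c$ of grade $+1$ and $b,d$ of grade $-1$; $S^2_q$ is the grade-zero subalgebra. (The differential is written $\mathrm{d}$, distinct from the generator $d$.) Adjoin $e^\pm$ of grade $\pm2$ with $e^\pm f=q^{g}fe^\pm$ for $f\in\mathbb{C}_q[SL_2]$ homogeneous of grade $g$, and $q^2e^+\wedge e^-+e^-\wedge e^+=0$, $e^\pm\wedge e^\pm=0$. $\Omega^1S^2_q$ is the set of $e^+f_++e^-f_-$ with $f_\pm$ of grade $\mp2$, $\Omega^2S^2_q$ the set of $f\,e^+\wedge e^-$ with $f\in S^2_q$ (free over the coefficients). $\mathrm{d}$ is the derivation with $\mathrm{d}a=q\,b\,e^+$, $\mathrm{d}b=a\,e^-$,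 $\mathrm{d}c=q\,d\,e^+$, $\mathrm{d}d=c\,e^-$, extended to forms by the graded Leibniz rule with $\mathrm{d}e^\pm=0$. Write $\mathrm{d}f=e^+\partial_+f+e^-\partial_-f$. The homotopy $\delta$ comes from the metric $\alpha(v^+\otimes v^-)+\beta(v^-\otimes v^+)$ ($v^\pm$ dual to $e^\pm$), the left connection with $\nabla e^\pm=0$, and interior product $v^+\lrcorner(e^+\wedge e^-)=\gamma e^-$, $v^-\lrcorner(e^+\wedge e^-)=-\epsilon e^+$; explicitly $\delta f=0$ on $S^2_q$, $\delta(e^+f_++e^-f_-)=\alpha q^{-2}\partial_-f_++\beta q^2\partial_+f_-$, and $\delta(f\,e^+\wedge e^-)=\alpha\gamma q^{-4}e^-\partial_-f-\beta\epsilon q^4e^+\partial_+f$. *)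

theory Defs
  imports "HOL-Library.Poly_Mapping" "HOL-Algebra.QuotRing" "HOL-Algebra.Algebraic_Closure_Type"
begin

section \<open>The free algebra on the six generators\<close>

text \<open>Words form the free monoid under concatenation; with this additive notation
  the convolution product of \<^theory>\<open>HOL-Library.Poly_Mapping\<close> on finitely supported
  functions from words to the complex numbers is that of the free associative unital algebra.\<close>

instantiation list :: (type) monoid_add
begin
definition zero_list :: "'a list" where "zero_list = []"
definition plus_list :: "'a list \<Rightarrow> 'a list \<Rightarrow> 'a list" where "plus_list = (@)"
instance by standard (simp_all add: zero_list_def plus_list_def)
end

text \<open>The last two generators are \<open>e\<^sup>+\<close> and \<open>e\<^sup>-\<close>.\<close>

datatype gen = Ga | Gb | Gc | Gd | Gep | Gem

type_synonym free_alg = "gen list \<Rightarrow>\<^sub>0 complex"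

definition var :: "gen \<Rightarrow> free_alg" where
  "var x = Poly_Mapping.single [x] 1"

definition scalar :: "complex \<Rightarrow> free_alg" where
  "scalar k = Poly_Mapping.single [] k"

fun gen_grade :: "gen \<Rightarrow> int" where
  "gen_grade Ga = 1"
| "gen_grade Gb = -1"
| "gen_grade Gc = 1"
| "gen_grade Gd = -1"
| "gen_grade Gep = 2"
| "gen_grade Gem = -2"

definition word_grade :: "gen list \<Rightarrow> int" where
  "word_grade w = sum_list (map gen_grade w)"

definition word_degree :: "gen list \<Rightarrow> nat" where
  "word_degree w = length (filter (\<lambda>x. x \<in> {Gep, Gem}) w)"

text \<open>Noncommutative polynomials in \<open>a, b, c, d\<close> alone, homogeneous of grade \<open>g\<close>.\<close>

definition homog_poly :: "int \<Rightarrow> free_alg set" where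
  "homog_poly g = {p. \<forall>w \<in> Poly_Mapping.keys p. word_degree w = 0 \<and> word_grade w = g}"

section \<open>The algebra of forms over the coordinate algebra of quantum SL(2)\<close>

definition SL2_relations :: "real \<Rightarrow> free_alg set" where
  "SL2_relations q =
    (let a = var Ga; b = var Gb; c = var Gc; d = var Gd; Q = scalar (complex_of_real q) in
     {b * a - Q * a * b,
      c * a - Q * a * c,
      d * b - Q * b * d,
      d * c - Q * c * d,
      c * b - b * c,
      d * a - a * d - scalar (complex_of_real (q * (1 - q powi (-2)))) * b * c,
      a * d - scalar (complex_of_real (q powi (-1))) * b * c - 1})"

definition form_relations :: "real \<Rightarrow> free_alg set" where
  "form_relations q =
     {var e * f - scalar (complex_of_real (q powi g)) * f * var e | e f g.
        e \<in> {Gep, Gem} \<and> f \<in> homog_poly g}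
     \<union> {scalar (complex_of_real (q\<^sup>2)) * var Gep * var Gem + var Gem * var Gep,
        var Gep * var Gep,
        var Gem * var Gem}"

abbreviation Free :: "free_alg ring" where
  "Free \<equiv> ring_of_type_algebra"

definition rel_ideal :: "real \<Rightarrow> free_alg set" where
  "rel_ideal q = Idl\<^bsub>Free\<^esub> (SL2_relations q \<union> form_relations q)"

text \<open>The result of adjoining \<open>e\<^sup>+\<close> and \<open>e\<^sup>-\<close> to the coordinate algebra, presented in one step by
  all generators and relations; its product includes the wedge product.  It is a
  free right module over the coordinate algebra with basis \<open>1, e\<^sup>+, e\<^sup>-, e\<^sup>+ \<and> e\<^sup>-\<close>, so the
  coordinate algebra is its subalgebra generated by \<open>a, b, c, d\<close>.\<close>

definition Forms :: "real \<Rightarrow> free_alg set ring" where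
  "Forms q = Free Quot (rel_ideal q)"

definition cls :: "real \<Rightarrow> free_alg \<Rightarrow> free_alg set" where
  "cls q p = rel_ideal q +>\<^bsub>Free\<^esub> p"

abbreviation elt :: "real \<Rightarrow> gen \<Rightarrow> free_alg set" where
  "elt q x \<equiv> cls q (var x)"

definition smul :: "real \<Rightarrow> complex \<Rightarrow> free_alg set \<Rightarrow> free_alg set" where
  "smul q k x = cls q (scalar k) \<otimes>\<^bsub>Forms q\<^esub> x"

abbreviation rsmul :: "real \<Rightarrow> real \<Rightarrow> free_alg set \<Rightarrow> free_alg set" where
  "rsmul q k x \<equiv> smul q (complex_of_real k) x"

definition CqSL2 :: "real \<Rightarrow> free_alg set set" where
  "CqSL2 q = cls q ` {p. \<forall>w \<in> Poly_Mapping.keys p. word_degree w = 0}"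

text \<open>The part of the coordinate algebra of grade \<open>g\<close>.\<close>

definition CqSL2_grade :: "real \<Rightarrow> int \<Rightarrow> free_alg set set" where
  "CqSL2_grade q g = cls q ` homog_poly g"

definition form_degree :: "real \<Rightarrow> nat \<Rightarrow> free_alg set set" where
  "form_degree q k = cls q ` {p. \<forall>w \<in> Poly_Mapping.keys p. word_degree w = k}"

definition ep_wedge_em :: "real \<Rightarrow> free_alg set" where
  "ep_wedge_em q = elt q Gep \<otimes>\<^bsub>Forms q\<^esub> elt q Gem"

section \<open>The quantum sphere and its forms\<close>

definition S2 :: "real \<Rightarrow> free_alg set set" where
  "S2 q = CqSL2_grade q 0"

definition Omega2_S2 :: "real \<Rightarrow> free_alg set set" where
  "Omega2_S2 q = {f \<otimes>\<^bsub>Forms q\<^esub> ep_wedge_em q | f. f \<in> S2 q}"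

section \<open>The differential\<close>

text \<open>The extensional function space makes the derivation below unique as a HOL function.
  On functions of grade other than zero it need not square to zero.\<close>

definition is_differential :: "real \<Rightarrow> (free_alg set \<Rightarrow> free_alg set) \<Rightarrow> bool" where
  "is_differential q D \<longleftrightarrow>
     D \<in> carrier (Forms q) \<rightarrow>\<^sub>E carrier (Forms q) \<and>
     (\<forall>x \<in> carrier (Forms q). \<forall>y \<in> carrier (Forms q).
        D (x \<oplus>\<^bsub>Forms q\<^esub> y) = D x \<oplus>\<^bsub>Forms q\<^esub> D y) \<and>
     (\<forall>k. \<forall>x \<in> carrier (Forms q). D (smul q k x) = smul q k (D x)) \<and>
     (\<forall>n. \<forall>x \<in> form_degree q n. \<forall>y \<in> carrier (Forms q).
        D (x \<otimes>\<^bsub>Forms q\<^esub> y) =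
          D x \<otimes>\<^bsub>Forms q\<^esub> y \<oplus>\<^bsub>Forms q\<^esub> smul q ((-1) ^ n) (x \<otimes>\<^bsub>Forms q\<^esub> D y)) \<and>
     D (elt q Ga) = rsmul q q (elt q Gb \<otimes>\<^bsub>Forms q\<^esub> elt q Gep) \<and>
     D (elt q Gb) = elt q Ga \<otimes>\<^bsub>Forms q\<^esub> elt q Gem \<and>
     D (elt q Gc) = rsmul q q (elt q Gd \<otimes>\<^bsub>Forms q\<^esub> elt q Gep) \<and>
     D (elt q Gd) = elt q Gc \<otimes>\<^bsub>Forms q\<^esub> elt q Gem \<and>
     D (elt q Gep) = \<zero>\<^bsub>Forms q\<^esub> \<and>
     D (elt q Gem) = \<zero>\<^bsub>Forms q\<^esub>"

definition diff :: "real \<Rightarrow> free_alg set \<Rightarrow> free_alg set" where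
  "diff q = (THE D. is_differential q D)"

text \<open>The unique coefficients in \<open>df = e\<^sup>+ \<partial>\<^sub>+f + e\<^sup>- \<partial>\<^sub>-f\<close>, for \<open>f\<close> in the coordinate algebra.\<close>

definition partials :: "real \<Rightarrow> free_alg set \<Rightarrow> free_alg set \<times> free_alg set" where
  "partials q f = (THE (fp, fm). fp \<in> CqSL2 q \<and> fm \<in> CqSL2 q \<and>
     diff q f = elt q Gep \<otimes>\<^bsub>Forms q\<^esub> fp \<oplus>\<^bsub>Forms q\<^esub> elt q Gem \<otimes>\<^bsub>Forms q\<^esub> fm)"

definition partial_p :: "real \<Rightarrow> free_alg set \<Rightarrow> free_alg set" where
  "partial_p q f = fst (partials q f)"

definition partial_m :: "real \<Rightarrow> free_alg set \<Rightarrow> free_alg set" where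
  "partial_m q f = snd (partials q f)"

section \<open>The homotopy and the Laplacian\<close>

text \<open>Every form on the sphere is uniquely
  \<open>f + (e\<^sup>+ f\<^sub>+ + e\<^sup>- f\<^sub>-) + h e\<^sup>+ \<and> e\<^sup>-\<close>, with
  \<open>f, h\<close> of grade \<open>0\<close> and \<open>f\<^sub>\<plusminus>\<close> of grade \<open>\<mp>2\<close>; \<open>delta\<close> is the
  sum of the maps prescribed in degrees 0, 1 and 2, being zero on \<open>f\<close>.\<close>

definition delta ::
  "real \<Rightarrow> real \<Rightarrow> real \<Rightarrow> real \<Rightarrow> real \<Rightarrow> free_alg set \<Rightarrow> free_alg set" where
  "delta q \<alpha> \<beta> \<gamma> \<epsilon> \<omega> = (THE \<eta>.
     \<exists>f \<in> S2 q. \<exists>fp \<in> CqSL2_grade q (-2). \<exists>fm \<in> CqSL2_grade q 2. \<exists>h \<in> S2 q.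
       \<omega> = f
         \<oplus>\<^bsub>Forms q\<^esub> (elt q Gep \<otimes>\<^bsub>Forms q\<^esub> fp \<oplus>\<^bsub>Forms q\<^esub> elt q Gem \<otimes>\<^bsub>Forms q\<^esub> fm)
         \<oplus>\<^bsub>Forms q\<^esub> h \<otimes>\<^bsub>Forms q\<^esub> ep_wedge_em q \<and>
       \<eta> = (rsmul q (\<alpha> * q powi (-2)) (partial_m q fp)
              \<oplus>\<^bsub>Forms q\<^esub> rsmul q (\<beta> * q\<^sup>2) (partial_p q fm))
         \<oplus>\<^bsub>Forms q\<^esub>
           (rsmul q (\<alpha> * \<gamma> * q powi (-4)) (elt q Gem \<otimes>\<^bsub>Forms q\<^esub> partial_m q h)
              \<ominus>\<^bsub>Forms q\<^esub> rsmul q (\<beta> * \<epsilon> * q ^ 4) (elt q Gep \<otimes>\<^bsub>Forms q\<^esub> partial_p q h)))"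

definition Laplacian ::
  "real \<Rightarrow> real \<Rightarrow> real \<Rightarrow> real \<Rightarrow> real \<Rightarrow> free_alg set \<Rightarrow> free_alg set" where
  "Laplacian q \<alpha> \<beta> \<gamma> \<epsilon> \<omega> =
     delta q \<alpha> \<beta> \<gamma> \<epsilon> (diff q \<omega>) \<oplus>\<^bsub>Forms q\<^esub> diff q (delta q \<alpha> \<beta> \<gamma> \<epsilon> \<omega>)"

definition eigenforms ::
  "real \<Rightarrow> (free_alg set \<Rightarrow> free_alg set) \<Rightarrow> free_alg set set \<Rightarrow> complex \<Rightarrow> free_alg set set" where
  "eigenforms q T V k = {\<omega> \<in> V. \<omega> \<noteq> \<zero>\<^bsub>Forms q\<^esub> \<and> T \<omega> = smul q k \<omega>}"

definition eigenvalues ::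
  "real \<Rightarrow> (free_alg set \<Rightarrow> free_alg set) \<Rightarrow> free_alg set set \<Rightarrow> complex set" where
  "eigenvalues q T V = {k. eigenforms q T V k \<noteq> {}}"

end

theory Submission
  imports Defs "HOL-Library.Product_Plus"
begin

text \<open>For a function \<open>f\<close> on the sphere, \<open>\<delta> f = 0\<close> and hence
  \<open>\<Delta> f = \<alpha> q\<^sup>-\<^sup>2 \<partial>\<^sub>- \<partial>\<^sub>+ f + \<beta> q\<^sup>2 \<partial>\<^sub>+ \<partial>\<^sub>- f\<close>.  The form \<open>f e\<^sup>+ e\<^sup>-\<close> is closed because there
  are no 3-forms, and for the chosen \<open>\<gamma>\<close> and \<open>\<epsilon>\<close> one has
  \<open>\<delta> (f e\<^sup>+ e\<^sup>-) = \<alpha> q\<^sup>-\<^sup>2 e\<^sup>- \<partial>\<^sub>- f - \<beta> e\<^sup>+ \<partial>\<^sub>+ f\<close>, whose differential is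
  \<open>(\<alpha> \<partial>\<^sub>+ \<partial>\<^sub>- f + \<beta> \<partial>\<^sub>- \<partial>\<^sub>+ f) e\<^sup>+ e\<^sup>-\<close>.  In grade zero the differential squares to zero, and the
  coefficient of \<open>e\<^sup>+ e\<^sup>-\<close> in \<open>d\<^sup>2 f = 0\<close> is the identity
  \<open>\<partial>\<^sub>- \<partial>\<^sub>+ f = q\<^sup>2 \<partial>\<^sub>+ \<partial>\<^sub>- f\<close>.  It turns both expressions into \<open>(\<alpha> + \<beta> q\<^sup>2) \<partial>\<^sub>+ \<partial>\<^sub>- f\<close>
  (\<open>laplacian_functions_and_2_forms\<close>).  The statements on eigenforms follow since \<open>e\<^sup>+ e\<^sup>-\<close> commutes with
  functions of grade zero and multiplication by it is injective on them.

  This argument presupposes that the differential, the partial derivatives and \<open>\<delta>\<close>, each of which is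
  defined by a unique description, exist and are unique.  All computations take place in the free
  algebra modulo the ideal of relations, and both facts needed there come from a representation of the
  free algebra that respects the relations (\<open>act_rel_ideal\<close>).  Triangular matrices give a derivation that
  preserves the ideal (\<open>dfree_rel_ideal\<close>), hence the differential.  Left multiplication on
  coordinates with respect to \<open>1, e\<^sup>+, e\<^sup>-, e\<^sup>+ e\<^sup>-\<close> shows that the forms are free over the
  coordinate algebra (\<open>forms_independent\<close>), hence all uniqueness.  Finally \<open>dfree_square\<close> computes \<open>d\<^sup>2\<close>
  on words: it multiplies a word of grade \<open>g\<close> by \<open>e\<^sup>+ e\<^sup>-\<close> and a multiple of a \<open>q\<close>-integer, which
  vanishes for \<open>g = 0\<close>.\<close>

section \<open>Polynomials and their grading\<close>

lemma word_grade_simps [simp]: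
  "word_grade [] = 0" "word_grade (x # w) = gen_grade x + word_grade w"
  "word_grade (v @ w) = word_grade v + word_grade w"
  by (simp_all add: word_grade_def)

lemma word_degree_simps [simp]:
  "word_degree [] = 0"
  "word_degree (x # w) = (if x \<in> {Gep, Gem} then 1 else 0) + word_degree w"
  "word_degree (v @ w) = word_degree v + word_degree w"
  by (simp_all add: word_degree_def)

definition degree_poly :: "nat \<Rightarrow> free_alg set" where
  "degree_poly n = {p. \<forall>w \<in> Poly_Mapping.keys p. word_degree w = n}"

lemma scalar_zero [simp]: "scalar 0 = 0"
  by (simp add: scalar_def)

lemma scalar_one [simp]: "scalar 1 = 1"
  by (simp add: scalar_def flip: zero_list_def)

lemma scalar_add: "scalar (k + l) = scalar k + scalar l"
  by (simp add: scalar_def single_add)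

lemma scalar_uminus: "scalar (- k) = - scalar k"
  by (simp add: scalar_def single_uminus)

lemma scalar_diff: "scalar (k - l) = scalar k - scalar l"
  by (simp add: scalar_def single_diff)

lemma scalar_mult: "scalar (k * l) = scalar k * scalar l"
  by (simp add: scalar_def mult_single plus_list_def)

lemma scalar_mult_single: "scalar k * Poly_Mapping.single w l = Poly_Mapping.single w (k * l)"
  by (simp add: scalar_def mult_single plus_list_def)

lemma single_mult_scalar: "Poly_Mapping.single w l * scalar k = Poly_Mapping.single w (k * l)"
  by (simp add: scalar_def mult_single plus_list_def mult.commute)

lemma var_mult_single: "var x * Poly_Mapping.single w k = Poly_Mapping.single (x # w) k"
  by (simp add: var_def mult_single plus_list_def)

lemma single_Nil_one: "Poly_Mapping.single [] 1 = (1::free_alg)"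
  by (simp flip: zero_list_def)

lemma single_conv_scalar: "Poly_Mapping.single w k = scalar k * Poly_Mapping.single w 1"
  by (simp add: scalar_mult_single)

lemma sum_monomials:
  "p = (\<Sum>w\<in>Poly_Mapping.keys p. Poly_Mapping.single w (Poly_Mapping.lookup p w))"
  by (rule poly_mapping_eqI)
    (auto simp: lookup_sum lookup_single when_def in_keys_iff sum.delta' sum.delta)

text \<open>Only monomials of the given polynomial occur in the \<open>single\<close> case, so that a homogeneous
  polynomial yields words of its own grade.\<close>

lemma free_alg_induct [case_names zero single add]:
  assumes "P 0" and single: "\<And>w k. w \<in> Poly_Mapping.keys p \<Longrightarrow> P (Poly_Mapping.single w k)"
    and add: "\<And>r s. P r \<Longrightarrow> P s \<Longrightarrow> P (r + s)"
  shows "P (p :: free_alg)"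
proof -
  have "P (\<Sum>w\<in>A. Poly_Mapping.single w (Poly_Mapping.lookup p w))"
    if "finite A" "A \<subseteq> Poly_Mapping.keys p" for A
    using that by (induction A) (auto intro: assms)
  from this[of "Poly_Mapping.keys p"] show ?thesis
    by (simp flip: sum_monomials)
qed

lemma scalar_commute: "p * scalar k = scalar k * p"
  by (induction p rule: free_alg_induct)
    (simp_all add: scalar_mult_single single_mult_scalar distrib_left distrib_right)

lemma scalar_left_commute: "p * (scalar k * r) = scalar k * (p * r)"
  by (metis mult.assoc scalar_commute)

lemma homog_poly_zero [simp]: "0 \<in> homog_poly g"
  by (simp add: homog_poly_def)

lemma homog_poly_add: "p \<in> homog_poly g \<Longrightarrow> r \<in> homog_poly g \<Longrightarrow> p + r \<in> homog_poly g"
  using keys_add[of p r] by (auto simp: homog_poly_def)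

lemma homog_poly_mult: "p \<in> homog_poly g \<Longrightarrow> r \<in> homog_poly h \<Longrightarrow> p * r \<in> homog_poly (g + h)"
  using keys_mult[of p r] by (fastforce simp: homog_poly_def plus_list_def)

lemma homog_poly_scalar: "scalar k \<in> homog_poly 0"
  by (simp add: homog_poly_def scalar_def)

lemma homog_poly_scalar_mult: "p \<in> homog_poly g \<Longrightarrow> scalar k * p \<in> homog_poly g"
  using homog_poly_mult[OF homog_poly_scalar] by simp

lemma homog_poly_uminus: "p \<in> homog_poly g \<Longrightarrow> - p \<in> homog_poly g"
  by (simp add: homog_poly_def in_keys_iff)

lemma homog_poly_diff: "p \<in> homog_poly g \<Longrightarrow> r \<in> homog_poly g \<Longrightarrow> p - r \<in> homog_poly g"
  using homog_poly_add[OF _ homog_poly_uminus] by fastforce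

lemma homog_poly_var: "x \<notin> {Gep, Gem} \<Longrightarrow> var x \<in> homog_poly (gen_grade x)"
  by (simp add: homog_poly_def var_def)

lemma homog_poly_single:
  "word_degree w = 0 \<Longrightarrow> Poly_Mapping.single w k \<in> homog_poly (word_grade w)"
  by (simp add: homog_poly_def)

lemma homog_poly_degree: "p \<in> homog_poly g \<Longrightarrow> p \<in> degree_poly 0"
  by (auto simp: homog_poly_def degree_poly_def)

lemma degree_poly_zero [simp]: "0 \<in> degree_poly n"
  by (simp add: degree_poly_def)

lemma degree_poly_add: "p \<in> degree_poly n \<Longrightarrow> r \<in> degree_poly n \<Longrightarrow> p + r \<in> degree_poly n"
  using keys_add[of p r] by (auto simp: degree_poly_def)

lemma degree_poly_uminus: "p \<in> degree_poly n \<Longrightarrow> - p \<in> degree_poly n"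
  by (simp add: degree_poly_def in_keys_iff)

lemma degree_poly_diff: "p \<in> degree_poly n \<Longrightarrow> r \<in> degree_poly n \<Longrightarrow> p - r \<in> degree_poly n"
  using degree_poly_add[OF _ degree_poly_uminus] by fastforce

lemma degree_poly_scalar: "scalar k \<in> degree_poly 0"
  by (simp add: degree_poly_def scalar_def)

lemma degree_poly_var: "var x \<in> degree_poly (if x \<in> {Gep, Gem} then 1 else 0)"
  by (simp add: degree_poly_def var_def)

section \<open>The ideal of relations\<close>

lemma Free_simps [simp]:
  "carrier Free = UNIV" "x \<otimes>\<^bsub>Free\<^esub> y = x * y" "x \<oplus>\<^bsub>Free\<^esub> y = x + y"
  "\<one>\<^bsub>Free\<^esub> = 1" "\<zero>\<^bsub>Free\<^esub> = 0"
  by (simp_all add: ring_of_type_algebra_def)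

lemma ring_Free: "ring Free"
proof -
  have "\<exists>y. y + x = 0" for x :: free_alg
    by (rule exI[of _ "- x"]) simp
  then show ?thesis
    by unfold_locales (auto simp: algebra_simps Units_def add_eq_0_iff)
qed

lemma Free_a_inv [simp]: "\<ominus>\<^bsub>Free\<^esub> x = - x"
proof -
  interpret ring Free by (rule ring_Free)
  show ?thesis
    using minus_equality[of "- x" x] by simp
qed

lemma ideal_Free_iff:
  "ideal K Free \<longleftrightarrow> 0 \<in> K \<and> (\<forall>x\<in>K. \<forall>y\<in>K. x + y \<in> K) \<and> (\<forall>x\<in>K. \<forall>y. y * x \<in> K \<and> x * y \<in> K)"
  (is "_ = ?R")
proof
  assume "ideal K Free"
  then interpret ideal K Free .
  show ?R
    using additive_subgroup.a_closed[OF additive_subgroup_axioms]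
      additive_subgroup.zero_closed[OF additive_subgroup_axioms] I_l_closed I_r_closed by auto
next
  assume R: ?R
  interpret ring Free by (rule ring_Free)
  have "inv\<^bsub>add_monoid Free\<^esub> x \<in> K" if "x \<in> K" for x
    using R that Free_a_inv[of x] unfolding a_inv_def by (metis mult_minus1)
  then have "subgroup K (add_monoid Free)"
    using R by (intro subgroup.intro) simp_all
  then show "ideal K Free"
    using R by (intro idealI ring_Free) auto
qed

lemma ideal_rel_ideal: "ideal (rel_ideal q) Free"
  unfolding rel_ideal_def by (rule ring.genideal_ideal[OF ring_Free]) simp

lemma rel_ideal_zero [simp]: "0 \<in> rel_ideal q"
  and rel_ideal_add: "x \<in> rel_ideal q \<Longrightarrow> y \<in> rel_ideal q \<Longrightarrow> x + y \<in> rel_ideal q"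
  and rel_ideal_mult_left: "x \<in> rel_ideal q \<Longrightarrow> y * x \<in> rel_ideal q"
  and rel_ideal_mult_right: "x \<in> rel_ideal q \<Longrightarrow> x * y \<in> rel_ideal q"
  using ideal_rel_ideal[of q] unfolding ideal_Free_iff by auto

lemma rel_ideal_uminus: "x \<in> rel_ideal q \<Longrightarrow> - x \<in> rel_ideal q"
  using rel_ideal_mult_left[of x q "- 1"] by simp

lemma rel_ideal_diff: "x \<in> rel_ideal q \<Longrightarrow> y \<in> rel_ideal q \<Longrightarrow> x - y \<in> rel_ideal q"
  using rel_ideal_add[OF _ rel_ideal_uminus] by fastforce

lemmas rel_ideal_intros =
  rel_ideal_add rel_ideal_diff rel_ideal_uminus rel_ideal_mult_left rel_ideal_mult_right

definition letter_relations :: "real \<Rightarrow> free_alg set" where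
  "letter_relations q =
     {var e * var x - scalar (complex_of_real (q powi gen_grade x)) * var x * var e | e x.
        e \<in> {Gep, Gem} \<and> x \<notin> {Gep, Gem}}"

definition wedge_relations :: "real \<Rightarrow> free_alg set" where
  "wedge_relations q =
     {scalar (complex_of_real (q\<^sup>2)) * var Gep * var Gem + var Gem * var Gep,
        var Gep * var Gep, var Gem * var Gem}"

text \<open>Moving \<open>e\<^sup>\<plusminus>\<close> past a word amounts to moving it past one letter after the other, so that the
  commutation relations for arbitrary homogeneous \<open>f\<close> follow from those for generators.  This
  leaves finitely many relations to check when a map is to be factored through the quotient.\<close>

lemma rel_ideal_least:
  assumes "q \<noteq> 0" and K: "ideal K Free"
    and rels: "SL2_relations q \<subseteq> K" "letter_relations q \<subseteq> K" "wedge_relations q \<subseteq> K"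
  shows "rel_ideal q \<subseteq> K"
proof -
  have K0: "0 \<in> K" and K_add: "\<And>x y. x \<in> K \<Longrightarrow> y \<in> K \<Longrightarrow> x + y \<in> K"
    and K_left: "\<And>x y. x \<in> K \<Longrightarrow> y * x \<in> K" and K_right: "\<And>x y. x \<in> K \<Longrightarrow> x * y \<in> K"
    using K unfolding ideal_Free_iff by auto
  let ?s = "\<lambda>g. scalar (complex_of_real (q powi g))"
  have word: "var e * Poly_Mapping.single w 1 - ?s (word_grade w) * Poly_Mapping.single w 1 * var e \<in> K"
    if "e \<in> {Gep, Gem}" "word_degree w = 0" for e w
    using that(2)
  proof (induction w)
    case Nil
    then show ?case by (simp add: single_Nil_one K0)
  next
    case (Cons x w)
    then have x: "x \<notin> {Gep, Gem}" and w: "word_degree w = 0"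
      by (auto split: if_splits)
    let ?W = "Poly_Mapping.single w 1 :: free_alg"
    have s: "?s (gen_grade x + word_grade w) = ?s (gen_grade x) * ?s (word_grade w)"
      using assms(1) by (simp add: power_int_add scalar_mult)
    have "var e * var x - ?s (gen_grade x) * var x * var e \<in> K"
      using rels(2) that(1) x unfolding letter_relations_def by blast
    then have "(var e * var x - ?s (gen_grade x) * var x * var e) * ?W
        + ?s (gen_grade x) * var x * (var e * ?W - ?s (word_grade w) * ?W * var e) \<in> K"
      using Cons.IH[OF w] by (intro K_add K_right K_left)
    also have "(var e * var x - ?s (gen_grade x) * var x * var e) * ?W
        + ?s (gen_grade x) * var x * (var e * ?W - ?s (word_grade w) * ?W * var e)
      = var e * (var x * ?W) - ?s (gen_grade x + word_grade w) * (var x * ?W) * var e"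
      unfolding s
      by (simp add: algebra_simps scalar_left_commute[of "var x"])
    finally show ?case
      by (simp add: var_mult_single)
  qed
  have "var e * f - ?s g * f * var e \<in> K"
    if e: "e \<in> {Gep, Gem}" and f: "f \<in> homog_poly g" for e f g
  proof (induction f rule: free_alg_induct)
    case (single w k)
    then have "word_degree w = 0" "word_grade w = g"
      using f by (auto simp: homog_poly_def)
    then have "scalar k * (var e * Poly_Mapping.single w 1
        - ?s g * Poly_Mapping.single w 1 * var e) \<in> K"
      using word[OF e] K_left by blast
    also have "scalar k * (var e * Poly_Mapping.single w 1 - ?s g * Poly_Mapping.single w 1 * var e)
      = var e * Poly_Mapping.single w k - ?s g * Poly_Mapping.single w k * var e"
      by (subst (3 4) single_conv_scalar, simp add: algebra_simps scalar_left_commute[of "var e"])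
        (rule scalar_left_commute)
    finally show ?case .
  next
    case (add r s)
    then show ?case
      using K_add[OF add] by (simp add: algebra_simps)
  qed (simp add: K0)
  then have "form_relations q \<subseteq> K"
    using rels(3) unfolding form_relations_def wedge_relations_def by blast
  then show ?thesis
    unfolding rel_ideal_def using rels(1)
    by (intro ring.genideal_minimal[OF ring_Free K]) simp
qed

lemma relations_in_rel_ideal:
  "SL2_relations q \<subseteq> rel_ideal q" "form_relations q \<subseteq> rel_ideal q"
  using ring.genideal_self[OF ring_Free, of "SL2_relations q \<union> form_relations q"]
  unfolding rel_ideal_def by auto

text \<open>As opaque constants that commute with the generators, \<open>q\<close> and its inverse let the simplifier
  bring products to a normal form: powers of \<open>q\<close> in front, generators in their given order.\<close>

definition qp :: "real \<Rightarrow> free_alg" where "qp q = scalar (complex_of_real q)"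
definition qm :: "real \<Rightarrow> free_alg" where "qm q = scalar (complex_of_real (inverse q))"

lemma q_commute:
  "p * qp q = qp q * p" "p * qm q = qm q * p"
  "p * (qp q * r) = qp q * (p * r)" "p * (qm q * r) = qm q * (p * r)"
  by (simp_all add: qp_def qm_def scalar_commute scalar_left_commute)

lemmas var_q_commute = q_commute[of "var x" for x]

lemma q_inverse:
  assumes "q \<noteq> 0"
  shows "qp q * qm q = 1" "qm q * qp q = 1" "qp q * (qm q * p) = p" "qm q * (qp q * p) = p"
proof -
  show *: "qp q * qm q = 1" "qm q * qp q = 1"
    using assms by (simp_all add: qp_def qm_def flip: scalar_mult of_real_mult)
  show "qp q * (qm q * p) = p" "qm q * (qp q * p) = p"
    using * by (simp_all flip: mult.assoc)
qed

lemmas q_simps = algebra_simps var_q_commute q_inverse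

lemma scalar_powi_conv:
  assumes "q \<noteq> 0"
  shows "scalar (complex_of_real (q powi gen_grade x)) =
    (case x of Ga \<Rightarrow> qp q | Gc \<Rightarrow> qp q | Gb \<Rightarrow> qm q | Gd \<Rightarrow> qm q
       | Gep \<Rightarrow> qp q * qp q | Gem \<Rightarrow> qm q * qm q)"
  by (cases x) (simp_all add: qp_def qm_def power_int_minus power2_eq_square flip: scalar_mult)

lemma SL2_relations_conv:
  assumes "q \<noteq> 0"
  shows "SL2_relations q =
     {var Gb * var Ga - qp q * (var Ga * var Gb),
      var Gc * var Ga - qp q * (var Ga * var Gc),
      var Gd * var Gb - qp q * (var Gb * var Gd),
      var Gd * var Gc - qp q * (var Gc * var Gd),
      var Gc * var Gb - var Gb * var Gc,
      var Gd * var Ga - var Ga * var Gd - (qp q - qm q) * (var Gb * var Gc),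
      var Ga * var Gd - qm q * (var Gb * var Gc) - 1}"
proof -
  have "q * (1 - q powi -2) = q - inverse q"
    using assms by (simp add: power_int_minus field_simps power2_eq_square)
  then have "scalar (complex_of_real (q * (1 - q powi -2))) = qp q - qm q"
    by (simp add: qp_def qm_def scalar_diff flip: of_real_inverse)
  then show ?thesis
    by (simp add: SL2_relations_def Let_def qp_def qm_def mult.assoc power_int_minus)
qed

lemma wedge_relations_conv:
  "wedge_relations q = {qp q * (qp q * (var Gep * var Gem)) + var Gem * var Gep,
      var Gep * var Gep, var Gem * var Gem}"
  by (simp add: wedge_relations_def qp_def power2_eq_square scalar_mult mult.assoc)

lemma SL2_in_rel_ideal:
  assumes "q \<noteq> 0"
  shows
    "var Gb * var Ga - qp q * (var Ga * var Gb) \<in> rel_ideal q"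
    "var Gc * var Ga - qp q * (var Ga * var Gc) \<in> rel_ideal q"
    "var Gd * var Gb - qp q * (var Gb * var Gd) \<in> rel_ideal q"
    "var Gd * var Gc - qp q * (var Gc * var Gd) \<in> rel_ideal q"
    "var Gc * var Gb - var Gb * var Gc \<in> rel_ideal q"
    "var Gd * var Ga - var Ga * var Gd - (qp q - qm q) * (var Gb * var Gc) \<in> rel_ideal q"
    "var Ga * var Gd - qm q * (var Gb * var Gc) - 1 \<in> rel_ideal q"
  using relations_in_rel_ideal(1)[of q] unfolding SL2_relations_conv[OF assms] by auto

lemma wedge_in_rel_ideal:
  "qp q * (qp q * (var Gep * var Gem)) + var Gem * var Gep \<in> rel_ideal q"
  "var Gep * var Gep \<in> rel_ideal q" "var Gem * var Gem \<in> rel_ideal q"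
proof -
  have "wedge_relations q \<subseteq> rel_ideal q"
    using relations_in_rel_ideal(2)[of q] by (auto simp: form_relations_def wedge_relations_def)
  then show
    "qp q * (qp q * (var Gep * var Gem)) + var Gem * var Gep \<in> rel_ideal q"
    "var Gep * var Gep \<in> rel_ideal q" "var Gem * var Gem \<in> rel_ideal q"
    unfolding wedge_relations_conv by auto
qed

lemma commute_in_rel_ideal:
  assumes "e \<in> {Gep, Gem}" and "f \<in> homog_poly g"
  shows "var e * f - scalar (complex_of_real (q powi g)) * f * var e \<in> rel_ideal q"
  using assms relations_in_rel_ideal(2)[of q] unfolding form_relations_def by blast

lemma letter_in_rel_ideal:
  assumes "q \<noteq> 0" and "e \<in> {Gep, Gem}"
  shows "var e * var Ga - qp q * (var Ga * var e) \<in> rel_ideal q"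
    "var e * var Gb - qm q * (var Gb * var e) \<in> rel_ideal q"
    "var e * var Gc - qp q * (var Gc * var e) \<in> rel_ideal q"
    "var e * var Gd - qm q * (var Gd * var e) \<in> rel_ideal q"
  using commute_in_rel_ideal[OF assms(2) homog_poly_var, of Ga q]
    commute_in_rel_ideal[OF assms(2) homog_poly_var, of Gb q]
    commute_in_rel_ideal[OF assms(2) homog_poly_var, of Gc q]
    commute_in_rel_ideal[OF assms(2) homog_poly_var, of Gd q]
  by (simp_all del: gen_grade.simps of_real_power_int add: scalar_powi_conv[OF assms(1)] mult.assoc)

section \<open>Actions of the free algebra\<close>

text \<open>By the universal property of the free algebra, arbitrary linear endomorphisms \<open>F x\<close> of a vector
  space define a representation \<open>act\<close>.  Both the differential and the coordinates of a form are read
  off from representations of this kind.\<close>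

locale free_action = Modules.module sc
  for sc :: "complex \<Rightarrow> 'v::ab_group_add \<Rightarrow> 'v" +
  fixes F :: "gen \<Rightarrow> 'v \<Rightarrow> 'v"
  assumes F_linear: "\<And>x. module_hom sc sc (F x)"
begin

definition act :: "free_alg \<Rightarrow> 'v \<Rightarrow> 'v" where
  "act p v = (\<Sum>w\<in>Poly_Mapping.keys p. sc (Poly_Mapping.lookup p w) (foldr F w v))"

lemma act_zero [simp]: "act 0 v = 0"
  by (simp add: act_def)

lemma act_single [simp]: "act (Poly_Mapping.single w k) v = sc k (foldr F w v)"
  by (cases "k = 0") (simp_all add: act_def)

lemma act_add: "act (p + r) v = act p v + act r v"
  unfolding act_def
  by (rule setsum_keys_plus_distrib) (simp_all add: scale_left_distrib)

lemma foldr_linear: "module_hom sc sc (foldr F w)"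
proof (induction w)
  case (Cons x w)
  then show ?case
    using module_hom_compose[OF Cons F_linear[of x]] by (simp add: comp_def)
qed (unfold_locales, auto)

lemma act_mult: "act (p * r) v = act p (act r v)"
proof (induction p rule: free_alg_induct)
  case (single w k)
  show ?case
  proof (induction r rule: free_alg_induct)
    case (single u l)
    then show ?case
      using module_hom.scale[OF foldr_linear[of w]] by (simp add: mult_single plus_list_def)
  next
    case (add r s)
    then show ?case
      using module_hom.add[OF foldr_linear[of w]]
      by (simp add: distrib_left act_add scale_right_distrib)
  next
    case zero
    then show ?case
      using module_hom.zero[OF foldr_linear[of w]] by simp
  qed
qed (simp_all add: distrib_right act_add)

lemma act_var [simp]: "act (var x) v = F x v"
  by (simp add: var_def)

lemma act_scalar [simp]: "act (scalar k) v = sc k v"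
  by (simp add: scalar_def)

lemma act_one [simp]: "act 1 v = v"
  by (metis act_scalar scale_one scalar_one)

lemma act_uminus: "act (- p) v = - act p v"
  using act_add[of p "- p" v] by (simp add: eq_neg_iff_add_eq_0 add.commute)

lemma act_diff: "act (p - r) v = act p v - act r v"
  using act_add[of p "- r" v] by (simp add: act_uminus)

lemmas act_simps = act_add act_diff act_mult act_uminus

text \<open>The polynomials that map everything into a submodule \<open>N\<close> form an ideal, which is two-sided
  because \<open>N\<close> is stable.  Hence a representation on the quotient by \<open>N\<close> factors through the relations
  as soon as the finitely many generating relations act as zero on it.\<close>

lemma act_rel_ideal:
  assumes "q \<noteq> 0" and N: "subspace N" and stable: "\<And>x v. v \<in> N \<Longrightarrow> F x v \<in> N"
    and rels: "\<And>r v. r \<in> SL2_relations q \<union> letter_relations q \<union> wedge_relations q \<Longrightarrow> act r v \<in> N"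
    and p: "p \<in> rel_ideal q"
  shows "act p v \<in> N"
proof -
  have "foldr F w v \<in> N" if "v \<in> N" for w v
    using that by (induction w) (auto intro: stable)
  then have act_N: "act p v \<in> N" if "v \<in> N" for p v
    using that by (induction p rule: free_alg_induct)
      (auto simp: act_add intro: subspace_0 subspace_add subspace_scale N)
  have "ideal {p. \<forall>v. act p v \<in> N} Free"
    unfolding ideal_Free_iff by (auto simp: act_simps act_N intro: subspace_0 subspace_add N)
  from rel_ideal_least[OF assms(1) this] rels have "rel_ideal q \<subseteq> {p. \<forall>v. act p v \<in> N}"
    by auto
  then show ?thesis
    using p by auto
qed

end

section \<open>The differential on the free algebra\<close>

fun d_gen :: "real \<Rightarrow> gen \<Rightarrow> free_alg" where
  "d_gen q Ga = qp q * (var Gb * var Gep)"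
| "d_gen q Gb = var Ga * var Gem"
| "d_gen q Gc = qp q * (var Gd * var Gep)"
| "d_gen q Gd = var Gc * var Gem"
| "d_gen q Gep = 0"
| "d_gen q Gem = 0"

fun gen_sign :: "gen \<Rightarrow> free_alg" where
  "gen_sign x = (if x \<in> {Gep, Gem} then - 1 else 1)"

text \<open>A graded derivation \<open>D\<close> amounts to an algebra homomorphism into the triangular matrices with
  rows \<open>(x, 0)\<close> and \<open>(D x, \<plusminus>x)\<close>.  These matrices act on columns \<open>(u, v)\<close>, which are written as
  pairs.\<close>

fun pair_scale :: "complex \<Rightarrow> free_alg \<times> free_alg \<Rightarrow> free_alg \<times> free_alg" where
  "pair_scale k (u, v) = (scalar k * u, scalar k * v)"

fun d_matrix :: "real \<Rightarrow> gen \<Rightarrow> free_alg \<times> free_alg \<Rightarrow> free_alg \<times> free_alg" where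
  "d_matrix q x (u, v) = (var x * u, d_gen q x * u + gen_sign x * (var x * v))"

lemma fst_pair_scale [simp]: "fst (pair_scale k v) = scalar k * fst v"
  and snd_pair_scale [simp]: "snd (pair_scale k v) = scalar k * snd v"
  by (cases v, simp)+

lemma module_pair_scale: "Modules.module pair_scale"
  by unfold_locales (auto simp: algebra_simps scalar_add scalar_mult)

interpretation pairs: Modules.module pair_scale
  by (rule module_pair_scale)

interpretation dact: free_action pair_scale "d_matrix q" for q
proof unfold_locales
  fix x r and v w :: "free_alg \<times> free_alg"
  obtain v1 v2 w1 w2 where [simp]: "v = (v1, v2)" "w = (w1, w2)"
    by (cases v, cases w)
  show "d_matrix q x (v + w) = d_matrix q x v + d_matrix q x w"
    by (simp add: algebra_simps)
  show "d_matrix q x (pair_scale r v) = pair_scale r (d_matrix q x v)"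
    by (simp add: algebra_simps scalar_left_commute[of "var x"] scalar_left_commute[of "d_gen q x"])
qed

lemma dact_q [simp]:
  "dact.act q (qp q') (u, v) = (qp q' * u, qp q' * v)"
  "dact.act q (qm q') (u, v) = (qm q' * u, qm q' * v)"
  by (simp_all add: qp_def qm_def del: of_real_inverse)

definition dfree :: "real \<Rightarrow> free_alg \<Rightarrow> free_alg" where
  "dfree q p = snd (dact.act q p (1, 0))"

lemma scalar_single_mult: "scalar k * (Poly_Mapping.single w 1 * u) = Poly_Mapping.single w k * u"
  by (simp add: scalar_mult_single flip: mult.assoc)

lemma dact_word:
  "foldr (d_matrix q) w (u, v) =
     (Poly_Mapping.single w 1 * u, snd (foldr (d_matrix q) w (1, 0)) * u
        + (- 1) ^ word_degree w * (Poly_Mapping.single w 1 * v))"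
proof (induction w arbitrary: u v)
  case (Cons x w)
  have x: "var x * ((- 1) ^ n * p) = (- 1) ^ n * (var x * p)" for n p
    by (cases "even n") simp_all
  define s where "s = snd (foldr (d_matrix q) w (1, 0))"
  have IH: "foldr (d_matrix q) w (u, v) =
    (Poly_Mapping.single w 1 * u, s * u + (- 1) ^ word_degree w * (Poly_Mapping.single w 1 * v))" for u v
    using Cons[of u v] by (simp add: s_def)
  show ?case
    by (simp add: IH algebra_simps x flip: var_mult_single)
qed (simp add: single_Nil_one)

lemma dfree_add: "dfree q (p + r) = dfree q p + dfree q r"
  by (simp add: dfree_def dact.act_add)

lemma dfree_diff: "dfree q (p - r) = dfree q p - dfree q r"
  by (simp add: dfree_def dact.act_diff)

lemma dfree_zero [simp]: "dfree q 0 = 0"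
  by (simp add: dfree_def)

lemma dfree_one [simp]: "dfree q 1 = 0"
  by (simp add: dfree_def)

lemma dfree_var [simp]: "dfree q (var x) = d_gen q x"
  by (simp add: dfree_def)

lemma dact_eq:
  assumes "p \<in> degree_poly n"
  shows "dact.act q p (u, v) = (p * u, dfree q p * u + (- 1) ^ n * (p * v))"
  unfolding dfree_def
proof (induction p rule: free_alg_induct)
  case (single w k)
  then have "word_degree w = n"
    using assms by (auto simp: degree_poly_def)
  then show ?case
    by (simp add: dact_word[of q w u v] distrib_left scalar_single_mult mult.assoc
        flip: scalar_left_commute[of "(- 1) ^ n" k])
qed (simp_all add: dact.act_add algebra_simps zero_prod_def)

lemma fst_dact: "fst (dact.act q p (u, v)) = p * u"
proof (induction p rule: free_alg_induct)
  case (single w k)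
  then show ?case
    by (simp add: dact_word[of q w u v] scalar_single_mult)
qed (simp_all add: dact.act_add algebra_simps)

lemma dact_one: "dact.act q p (1, 0) = (p, dfree q p)"
  by (rule prod_eqI) (simp_all add: fst_dact dfree_def)

text \<open>The graded Leibniz rule is the lower left entry of a product of two matrices.\<close>

lemma dfree_mult:
  assumes "p \<in> degree_poly n"
  shows "dfree q (p * r) = dfree q p * r + (- 1) ^ n * (p * dfree q r)"
proof -
  have "dfree q (p * r) = snd (dact.act q p (dact.act q r (1, 0)))"
    unfolding dfree_def dact.act_mult ..
  then show ?thesis
    unfolding dact_one
    by (simp add: dact_eq[OF assms])
qed

lemma dfree_scalar: "dfree q (scalar k * p) = scalar k * dfree q p"
proof -
  have "dfree q (scalar k) = 0"
    by (simp add: dfree_def)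
  then show ?thesis
    using dfree_mult[OF degree_poly_scalar] by simp
qed

lemma dfree_q:
  "dfree q (qp q' * p) = qp q' * dfree q p" "dfree q (qm q' * p) = qm q' * dfree q p"
  by (simp_all only: qp_def qm_def dfree_scalar)

lemma dfree_var_mult: "dfree q (var x * p) = d_gen q x * p + gen_sign x * (var x * dfree q p)"
  using dfree_mult[OF degree_poly_var, of q x p] by simp

text \<open>The second component is \<open>D r * u \<plusminus> r * v\<close>, so the point is that the differential of a relation is a
  consequence of the relations.  In each combination below, the brackets containing \<open>e\<^sup>\<plusminus>\<close> move the
  one-form to the right; the coefficients that remain either cancel or are multiples of the
  relations among \<open>a, b, c, d\<close>.\<close>

lemma d_matrix_SL2:
  assumes q: "q \<noteq> 0" and r: "r \<in> SL2_relations q"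
  shows "snd (dact.act q r (u, v)) \<in> rel_ideal q"
proof -
  note m = SL2_in_rel_ideal[OF q] letter_in_rel_ideal[OF q, of Gep, simplified]
    letter_in_rel_ideal[OF q, of Gem, simplified]
  let ?a = "var Ga" and ?b = "var Gb" and ?c = "var Gc" and ?d = "var Gd"
    and ?e = "var Gep" and ?f = "var Gem" and ?Q = "qp q" and ?q = "qm q"
  let ?A = "(?b * ?a - ?Q * (?a * ?b)) * v + (?a * (?f * ?a - ?Q * (?a * ?f))
    - ?Q * (?Q * (?b * (?e * ?b - ?q * (?b * ?e))))) * u"
  let ?B = "(?c * ?a - ?Q * (?a * ?c)) * v + (?Q * (?d * (?e * ?a - ?Q * (?a * ?e)))
    - ?Q * (?Q * (?b * (?e * ?c - ?Q * (?c * ?e))))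
    + ?Q * (?Q * ((?d * ?a - ?a * ?d - (?Q - ?q) * (?b * ?c)) * ?e))
    + ?Q * ((?c * ?b - ?b * ?c) * ?e)) * u"
  let ?C = "(?d * ?b - ?Q * (?b * ?d)) * v + (?c * (?f * ?b - ?q * (?b * ?f))
    - ?Q * (?a * (?f * ?d - ?q * (?d * ?f)))
    + (?d * ?a - ?a * ?d - (?Q - ?q) * (?b * ?c)) * ?f + ?q * ((?c * ?b - ?b * ?c) * ?f)) * u"
  let ?D = "(?d * ?c - ?Q * (?c * ?d)) * v + (?c * (?f * ?c - ?Q * (?c * ?f))
    - ?Q * (?Q * (?d * (?e * ?d - ?q * (?d * ?e))))) * u"
  let ?E = "(?c * ?b - ?b * ?c) * v + (?Q * (?d * (?e * ?b - ?q * (?b * ?e)))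
    - ?a * (?f * ?c - ?Q * (?c * ?f)) + (?d * ?b - ?Q * (?b * ?d)) * ?e
    + (?c * ?a - ?Q * (?a * ?c)) * ?f) * u"
  let ?F = "(?d * ?a - ?a * ?d - (?Q - ?q) * (?b * ?c)) * v + (?c * (?f * ?a - ?Q * (?a * ?f))
    - ?Q * (?b * (?e * ?d - ?q * (?d * ?e))) - (?Q - ?q) * (?a * (?f * ?c - ?Q * (?c * ?f)))
    + ?Q * ((?c * ?a - ?Q * (?a * ?c)) * ?f) + ?Q * ((?d * ?b - ?Q * (?b * ?d)) * ?e)) * u"
  let ?G = "(?a * ?d - ?q * (?b * ?c) - 1) * v + (?Q * (?b * (?e * ?d - ?q * (?d * ?e)))
    - ?q * (?a * (?f * ?c - ?Q * (?c * ?f)))) * u"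
  have mem: "?A \<in> rel_ideal q" "?B \<in> rel_ideal q" "?C \<in> rel_ideal q" "?D \<in> rel_ideal q"
    "?E \<in> rel_ideal q" "?F \<in> rel_ideal q" "?G \<in> rel_ideal q"
    by (blast intro: rel_ideal_intros m)+
  let ?act = "\<lambda>r. snd (dact.act q r (u, v))"
  have eqs: "?act (?b * ?a - ?Q * (?a * ?b)) = ?A" "?act (?c * ?a - ?Q * (?a * ?c)) = ?B"
    "?act (?d * ?b - ?Q * (?b * ?d)) = ?C" "?act (?d * ?c - ?Q * (?c * ?d)) = ?D"
    "?act (?c * ?b - ?b * ?c) = ?E" "?act (?d * ?a - ?a * ?d - (?Q - ?q) * (?b * ?c)) = ?F"
    "?act (?a * ?d - ?q * (?b * ?c) - 1) = ?G"
    by (simp_all add: dact.act_simps q_simps q)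
  show ?thesis
    using r unfolding SL2_relations_conv[OF q]
    by (elim insertE emptyE) (simp_all only: eqs mem)
qed

text \<open>Differentiating \<open>e x = q\<^sup>g x e\<close> gives \<open>- e dx = q\<^sup>g dx e\<close>, with a minus sign because \<open>e\<close> has degree
  one.  Since \<open>dx\<close> is a multiple of \<open>y e\<^sup>\<plusminus>\<close> for a single generator \<open>y\<close>, this is the commutation
  relation for \<open>y\<close> together with the wedge relations.\<close>

lemma d_matrix_letter:
  assumes q: "q \<noteq> 0" and r: "r \<in> letter_relations q"
  shows "snd (dact.act q r (u, v)) \<in> rel_ideal q"
proof -
  note m = letter_in_rel_ideal[OF q, of Gep, simplified]
    letter_in_rel_ideal[OF q, of Gem, simplified] wedge_in_rel_ideal
  have a: "snd (dact.act q (var e * x - qp q * (x * var e)) (u, v)) \<in> rel_ideal q"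
    if e: "e \<in> {Gep, Gem}" and x: "(x, y) \<in> {(var Ga, var Gb), (var Gc, var Gd)}" for e x y
  proof -
    have x_in: "var e * x - qp q * (x * var e) \<in> rel_ideal q"
      and y_in: "var e * y - qm q * (y * var e) \<in> rel_ideal q"
      using x letter_in_rel_ideal[OF q e] by auto
    have wedge: "qp q * (qp q * (var Gep * var e)) + var e * var Gep \<in> rel_ideal q"
      using e by (auto intro: rel_ideal_intros wedge_in_rel_ideal)
    let ?z = "- ((var e * x - qp q * (x * var e)) * v) - (qp q * ((var e * y - qm q * (y * var e)) * var Gep)
        + y * (qp q * (qp q * (var Gep * var e)) + var e * var Gep)) * u"
    have "?z \<in> rel_ideal q"
      by (blast intro: rel_ideal_intros x_in y_in wedge)
    moreover have "?z = snd (dact.act q (var e * x - qp q * (x * var e)) (u, v))"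
      using e x by (auto simp: dact.act_simps q_simps q)
    ultimately show ?thesis by simp
  qed
  have b: "snd (dact.act q (var e * x - qm q * (x * var e)) (u, v)) \<in> rel_ideal q"
    if e: "e \<in> {Gep, Gem}" and x: "(x, y) \<in> {(var Gb, var Ga), (var Gd, var Gc)}" for e x y
  proof -
    have x_in: "var e * x - qm q * (x * var e) \<in> rel_ideal q"
      and y_in: "var e * y - qp q * (y * var e) \<in> rel_ideal q"
      using x letter_in_rel_ideal[OF q e] by auto
    have wedge: "qp q * (qp q * (var e * var Gem)) + var Gem * var e \<in> rel_ideal q"
      using e by (auto intro: rel_ideal_intros wedge_in_rel_ideal)
    let ?z = "- ((var e * x - qm q * (x * var e)) * v) - ((var e * y - qp q * (y * var e)) * var Gem
        + qm q * (y * (qp q * (qp q * (var e * var Gem)) + var Gem * var e))) * u"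
    have "?z \<in> rel_ideal q"
      by (blast intro: rel_ideal_intros x_in y_in wedge)
    moreover have "?z = snd (dact.act q (var e * x - qm q * (x * var e)) (u, v))"
      using e x by (auto simp: dact.act_simps q_simps q)
    ultimately show ?thesis by simp
  qed
  from r obtain e x where e: "e \<in> {Gep, Gem}" and x: "x \<notin> {Gep, Gem}"
    and r_eq: "r = var e * var x - scalar (complex_of_real (q powi gen_grade x)) * (var x * var e)"
    unfolding letter_relations_def mult.assoc by blast
  show ?thesis
    unfolding r_eq scalar_powi_conv[OF q]
    using x a[OF e, of "var Ga" "var Gb"] a[OF e, of "var Gc" "var Gd"]
      b[OF e, of "var Gb" "var Ga"] b[OF e, of "var Gd" "var Gc"]
    by (cases x) simp_all
qed

lemma d_matrix_wedge:
  assumes r: "r \<in> wedge_relations q"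
  shows "snd (dact.act q r (u, v)) \<in> rel_ideal q"
proof -
  have "snd (dact.act q r (u, v)) = r * v"
    using r unfolding wedge_relations_conv by (auto simp: dact.act_simps algebra_simps)
  moreover have "r \<in> rel_ideal q"
    using r wedge_in_rel_ideal unfolding wedge_relations_conv by blast
  ultimately show ?thesis
    by (simp add: rel_ideal_mult_right)
qed

lemma relations_conv_in_rel_ideal:
  "SL2_relations q \<union> letter_relations q \<union> wedge_relations q \<subseteq> rel_ideal q"
proof -
  have "letter_relations q \<subseteq> rel_ideal q"
    unfolding letter_relations_def
    using commute_in_rel_ideal homog_poly_var by blast
  moreover have "wedge_relations q \<subseteq> rel_ideal q"
    unfolding wedge_relations_conv using wedge_in_rel_ideal by blast
  ultimately show ?thesis
    using relations_in_rel_ideal(1) by blast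
qed

lemma dfree_rel_ideal:
  assumes q: "q \<noteq> 0" and p: "p \<in> rel_ideal q"
  shows "dfree q p \<in> rel_ideal q"
proof -
  let ?N = "rel_ideal q \<times> rel_ideal q"
  have "dact.act q p (1, 0) \<in> ?N"
  proof (rule dact.act_rel_ideal[OF q _ _ _ p])
    show "pairs.subspace ?N"
      unfolding pairs.subspace_def
      by (auto simp: zero_prod_def intro: rel_ideal_intros)
    show "d_matrix q x v \<in> ?N" if "v \<in> ?N" for x v
      using that by (cases v) (auto intro!: rel_ideal_add rel_ideal_mult_left intro: rel_ideal_uminus)
    show "dact.act q r v \<in> ?N" if "r \<in> SL2_relations q \<union> letter_relations q \<union> wedge_relations q" for r v
    proof (cases v)
      case (Pair u w)
      have "r \<in> rel_ideal q"
        using that relations_conv_in_rel_ideal by blast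
      then have "fst (dact.act q r (u, w)) \<in> rel_ideal q"
        by (simp add: fst_dact rel_ideal_mult_right)
      moreover have "snd (dact.act q r (u, w)) \<in> rel_ideal q"
        using that d_matrix_SL2[OF q] d_matrix_letter[OF q] d_matrix_wedge by blast
      ultimately show ?thesis
        by (simp add: Pair mem_Times_iff)
    qed
  qed
  then show ?thesis
    by (simp add: dact_one)
qed

section \<open>Freeness of the forms over the coordinate algebra\<close>

type_synonym quad = "(free_alg \<times> free_alg) \<times> (free_alg \<times> free_alg)"

fun quad_scale :: "complex \<Rightarrow> quad \<Rightarrow> quad" where
  "quad_scale k ((u, v), (w, z)) = ((scalar k * u, scalar k * v), (scalar k * w, scalar k * z))"

text \<open>Left multiplication by a generator on \<open>u + e\<^sup>+ v + e\<^sup>- w + e\<^sup>+ e\<^sup>- z\<close>, written as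
  \<open>((u, v), (w, z))\<close>.  Moving a generator of grade \<open>g\<close> to the right of \<open>e\<^sup>\<plusminus>\<close> costs \<open>q\<^sup>-\<^sup>g\<close>,
  and \<open>e\<^sup>- e\<^sup>+ = - q\<^sup>2 e\<^sup>+ e\<^sup>-\<close> accounts for the entry \<open>- q\<^sup>2 v\<close>.\<close>

fun coord_mult :: "real \<Rightarrow> gen \<Rightarrow> quad \<Rightarrow> quad" where
  "coord_mult q Gep ((u, v), (w, z)) = ((0, u), (0, w))"
| "coord_mult q Gem ((u, v), (w, z)) = ((0, 0), (u, - (qp q * (qp q * v))))"
| "coord_mult q x ((u, v), (w, z)) =
     (let t = (if x \<in> {Ga, Gc} then qm q else qp q)
      in ((var x * u, t * (var x * v)), (t * (var x * w), t * (t * (var x * z)))))"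

lemma module_quad_scale: "Modules.module quad_scale"
  by unfold_locales (auto simp: algebra_simps scalar_add scalar_mult)

interpretation quads: Modules.module quad_scale
  by (rule module_quad_scale)

interpretation cact: free_action quad_scale "coord_mult q" for q
proof unfold_locales
  fix x r and v w :: quad
  obtain v1 v2 v3 v4 w1 w2 w3 w4 where [simp]: "v = ((v1, v2), (v3, v4))" "w = ((w1, w2), (w3, w4))"
    by (metis prod.exhaust)
  have s: "scalar r * (qp q * y) = qp q * (scalar r * y)" "scalar r * (qm q * y) = qm q * (scalar r * y)"
    for y by (simp_all only: qp_def qm_def scalar_left_commute[of "scalar r"])
  show "coord_mult q x (v + w) = coord_mult q x v + coord_mult q x w"
    by (cases x) (simp_all add: algebra_simps Let_def zero_prod_def)
  show "coord_mult q x (quad_scale r v) = quad_scale r (coord_mult q x v)"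
    by (cases x) (simp_all add: Let_def scalar_left_commute[of "var x" for x] s)
qed

lemma cact_q [simp]:
  "cact.act q (qp q') ((u, v), (w, z)) = ((qp q' * u, qp q' * v), (qp q' * w, qp q' * z))"
  "cact.act q (qm q') ((u, v), (w, z)) = ((qm q' * u, qm q' * v), (qm q' * w, qm q' * z))"
  by (simp_all add: qp_def qm_def del: of_real_inverse)

definition quad_ideal :: "real \<Rightarrow> quad set" where
  "quad_ideal q = (rel_ideal q \<times> rel_ideal q) \<times> (rel_ideal q \<times> rel_ideal q)"

lemma quad_ideal_iff [simp]:
  "((u, v), (w, z)) \<in> quad_ideal q \<longleftrightarrow>
     u \<in> rel_ideal q \<and> v \<in> rel_ideal q \<and> w \<in> rel_ideal q \<and> z \<in> rel_ideal q"
  by (auto simp: quad_ideal_def)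

text \<open>Every relation among \<open>a, b, c, d\<close> is homogeneous for the grading, so the twist on the coordinates
  only multiplies it by a power \<open>t\<close> of \<open>q\<close>.\<close>

lemma coord_mult_SL2:
  assumes q: "q \<noteq> 0" and r: "r \<in> SL2_relations q"
  shows "cact.act q r v \<in> quad_ideal q"
proof -
  obtain v1 v2 v3 v4 where v: "v = ((v1, v2), (v3, v4))"
    by (metis prod.exhaust)
  let ?a = "var Ga" and ?b = "var Gb" and ?c = "var Gc" and ?d = "var Gd"
    and ?Q = "qp q" and ?q = "qm q"
  let ?R = "\<lambda>t r. ((r * v1, t * (r * v2)), (t * (r * v3), t * (t * (r * v4))))"
  have eqs: "cact.act q (?b * ?a - ?Q * (?a * ?b)) v = ?R 1 (?b * ?a - ?Q * (?a * ?b))"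
    "cact.act q (?c * ?a - ?Q * (?a * ?c)) v = ?R (?q * ?q) (?c * ?a - ?Q * (?a * ?c))"
    "cact.act q (?d * ?b - ?Q * (?b * ?d)) v = ?R (?Q * ?Q) (?d * ?b - ?Q * (?b * ?d))"
    "cact.act q (?d * ?c - ?Q * (?c * ?d)) v = ?R 1 (?d * ?c - ?Q * (?c * ?d))"
    "cact.act q (?c * ?b - ?b * ?c) v = ?R 1 (?c * ?b - ?b * ?c)"
    "cact.act q (?d * ?a - ?a * ?d - (?Q - ?q) * (?b * ?c)) v =
       ?R 1 (?d * ?a - ?a * ?d - (?Q - ?q) * (?b * ?c))"
    "cact.act q (?a * ?d - ?q * (?b * ?c) - 1) v = ?R 1 (?a * ?d - ?q * (?b * ?c) - 1)"
    by (simp_all add: v cact.act_simps Let_def q_simps q)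
  have "\<exists>t. cact.act q r v = ?R t r"
    using r unfolding SL2_relations_conv[OF q]
    by (elim insertE emptyE) (simp_all only:, (rule exI, rule eqs)+)
  then obtain t where "cact.act q r v = ?R t r" ..
  moreover have "r * x \<in> rel_ideal q" for x
    using r relations_in_rel_ideal(1) rel_ideal_mult_right by blast
  ultimately show ?thesis
    by (simp add: rel_ideal_mult_left)
qed

text \<open>The twist by \<open>q\<^sup>-\<^sup>g\<close> is chosen so that the relations involving \<open>e\<^sup>\<plusminus>\<close> hold exactly, not just
  modulo the ideal.\<close>

lemma coord_mult_forms:
  assumes q: "q \<noteq> 0" and r: "r \<in> letter_relations q \<union> wedge_relations q"
  shows "cact.act q r v = 0"
proof -
  obtain v1 v2 v3 v4 where v: "v = ((v1, v2), (v3, v4))"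
    by (metis prod.exhaust)
  from r show ?thesis
  proof
    assume "r \<in> letter_relations q"
    then obtain e x where e: "e \<in> {Gep, Gem}" and x: "x \<notin> {Gep, Gem}"
      and r_eq: "r = var e * var x - scalar (complex_of_real (q powi gen_grade x)) * (var x * var e)"
      unfolding letter_relations_def mult.assoc by blast
    show ?thesis
      unfolding r_eq scalar_powi_conv[OF q] v using e x
      by (cases x) (auto simp: cact.act_simps Let_def q_simps q zero_prod_def)
  next
    assume "r \<in> wedge_relations q"
    then show ?thesis
      unfolding wedge_relations_conv v
      by (auto simp: cact.act_simps Let_def q_simps q zero_prod_def)
  qed
qed

lemma cact_rel_ideal:
  assumes q: "q \<noteq> 0" and p: "p \<in> rel_ideal q"
  shows "cact.act q p v \<in> quad_ideal q"
proof (rule cact.act_rel_ideal[OF q _ _ _ p])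
  show "quads.subspace (quad_ideal q)"
    unfolding quads.subspace_def
    by (auto simp: zero_prod_def quad_ideal_def intro: rel_ideal_intros)
  then have "0 \<in> quad_ideal q"
    by (rule quads.subspace_0)
  then show "cact.act q r v \<in> quad_ideal q"
    if "r \<in> SL2_relations q \<union> letter_relations q \<union> wedge_relations q" for r v
    using that
    by (elim UnE) (simp_all add: coord_mult_SL2[OF q] coord_mult_forms[OF q])
  show "coord_mult q x v \<in> quad_ideal q" if "v \<in> quad_ideal q" for x v
  proof -
    obtain v1 v2 v3 v4 where v: "v = ((v1, v2), (v3, v4))"
      by (metis prod.exhaust)
    then show ?thesis
      using that
      by (cases x) (auto simp: Let_def intro!: rel_ideal_mult_left rel_ideal_uminus)
  qed
qed

lemma cact_degree_0:
  assumes "p \<in> degree_poly 0"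
  shows "cact.act q p ((u, 0), (0, 0)) = ((p * u, 0), (0, 0))"
proof (induction p rule: free_alg_induct)
  case (single w k)
  then have "word_degree w = 0"
    using assms by (auto simp: degree_poly_def)
  then have "foldr (coord_mult q) w ((u, 0), (0, 0)) = ((Poly_Mapping.single w 1 * u, 0), (0, 0))"
  proof (induction w)
    case (Cons x w)
    then have "x \<notin> {Gep, Gem}" "word_degree w = 0"
      by (auto split: if_splits)
    then show ?case
      using Cons.IH by (cases x) (simp_all add: Let_def mult.assoc flip: var_mult_single)
  qed (simp add: single_Nil_one)
  then show ?case
    by (simp add: scalar_single_mult)
qed (simp_all add: cact.act_add distrib_right zero_prod_def)

text \<open>A form acts on \<open>1\<close> by producing its coordinates, while a consequence of the relations produces
  coordinates that vanish modulo the relations.  This is the freeness on which the uniqueness of the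
  partial derivatives and of the decomposition of a form rests.\<close>

lemma forms_independent:
  assumes q: "q \<noteq> 0"
    and deg: "f \<in> degree_poly 0" "fp \<in> degree_poly 0" "fm \<in> degree_poly 0" "h \<in> degree_poly 0"
    and zero: "f + (var Gep * fp + var Gem * fm) + var Gep * var Gem * h \<in> rel_ideal q"
  shows "f \<in> rel_ideal q" "fp \<in> rel_ideal q" "fm \<in> rel_ideal q" "h \<in> rel_ideal q"
proof -
  have "cact.act q (f + (var Gep * fp + var Gem * fm) + var Gep * var Gem * h) ((1, 0), (0, 0))
    = ((f, fp), (fm, h))"
    by (simp add: cact.act_simps cact_degree_0 deg)
  then have "((f, fp), (fm, h)) \<in> quad_ideal q"
    using cact_rel_ideal[OF q zero, of "((1, 0), (0, 0))"] by simp
  then show "f \<in> rel_ideal q" "fp \<in> rel_ideal q" "fm \<in> rel_ideal q" "h \<in> rel_ideal q"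
    by simp_all
qed

section \<open>The partial derivatives and the square of the differential\<close>

text \<open>The coefficients are found by the Leibniz rule, letter by letter: \<open>d(x w) = dx w + x dw\<close>, and
  moving \<open>e\<^sup>\<plusminus>\<close> to the front past a generator of grade \<open>g\<close> costs \<open>q\<^sup>-\<^sup>g\<close>.\<close>

lemma dfree_decomposition:
  assumes q: "q \<noteq> 0" and p: "p \<in> homog_poly g"
  shows "\<exists>fp\<in>homog_poly (g - 2). \<exists>fm\<in>homog_poly (g + 2).
    dfree q p - (var Gep * fp + var Gem * fm) \<in> rel_ideal q"
proof (induction p rule: free_alg_induct)
  case zero
  show ?case
    by (rule bexI[of _ 0] | simp)+
next
  case (add r s)
  then obtain rp rm sp sm where *: "rp \<in> homog_poly (g - 2)" "rm \<in> homog_poly (g + 2)"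
      "sp \<in> homog_poly (g - 2)" "sm \<in> homog_poly (g + 2)"
    and "dfree q r - (var Gep * rp + var Gem * rm) \<in> rel_ideal q"
      "dfree q s - (var Gep * sp + var Gem * sm) \<in> rel_ideal q"
    by blast
  then have "dfree q (r + s) - (var Gep * (rp + sp) + var Gem * (rm + sm)) \<in> rel_ideal q"
    using rel_ideal_add by (fastforce simp: dfree_add algebra_simps)
  with * show ?case
    by (meson homog_poly_add)
next
  case (single w k)
  then have w: "word_degree w = 0" "word_grade w = g"
    using p by (auto simp: homog_poly_def)
  have "\<exists>fp\<in>homog_poly (word_grade w - 2). \<exists>fm\<in>homog_poly (word_grade w + 2).
    dfree q (Poly_Mapping.single w 1) - (var Gep * fp + var Gem * fm) \<in> rel_ideal q"
    using w(1)
  proof (induction w)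
    case Nil
    show ?case
      by (rule bexI[of _ 0] | simp add: single_Nil_one)+
  next
    case (Cons x w)
    define W :: free_alg where "W = Poly_Mapping.single w 1"
    have x: "x \<notin> {Gep, Gem}" and w: "word_degree w = 0"
      using Cons.prems by (auto split: if_splits)
    have W: "W \<in> homog_poly (word_grade w)"
      unfolding W_def by (rule homog_poly_single[OF w])
    from Cons.IH[OF w] obtain fp fm where fp: "fp \<in> homog_poly (word_grade w - 2)"
      and fm: "fm \<in> homog_poly (word_grade w + 2)"
      and W_in: "dfree q W - (var Gep * fp + var Gem * fm) \<in> rel_ideal q"
      unfolding W_def by blast
    have homog: "var x * fp \<in> homog_poly (gen_grade x + (word_grade w - 2))"
      "var x * fm \<in> homog_poly (gen_grade x + (word_grade w + 2))"
      "\<And>y. y \<notin> {Gep, Gem} \<Longrightarrow> var y * W \<in> homog_poly (gen_grade y + word_grade w)"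
      using homog_poly_mult[OF homog_poly_var] x W fp fm by blast+
    have d: "dfree q (Poly_Mapping.single (x # w) 1) = d_gen q x * W + var x * dfree q W"
      unfolding var_mult_single[symmetric] dfree_var_mult W_def using x by auto
    note qp_homog = homog_poly_scalar_mult[of _ _ "complex_of_real q", folded qp_def]
      homog_poly_scalar_mult[of _ _ "complex_of_real (inverse q)", folded qm_def]
    have ac: ?case
      if x: "x \<in> {Ga, Gc}" and y: "(x, y) \<in> {(Ga, Gb), (Gc, Gd)}" for y
    proof -
      define P where "P = qp q * (qp q * (var y * W)) + qm q * (var x * fp)"
      define M where "M = qm q * (var x * fm)"
      have "P \<in> homog_poly (word_grade (x # w) - 2)" "M \<in> homog_poly (word_grade (x # w) + 2)"
        unfolding P_def M_def using x y homog(1,2) homog(3)[of y]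
        by (auto intro!: homog_poly_add qp_homog simp: algebra_simps)
      have y_in: "var Gep * var y - qm q * (var y * var Gep) \<in> rel_ideal q"
        and x_in: "var Gep * var x - qp q * (var x * var Gep) \<in> rel_ideal q"
          "var Gem * var x - qp q * (var x * var Gem) \<in> rel_ideal q"
        using x y letter_in_rel_ideal[OF q] by auto
      let ?z = "var x * (dfree q W - (var Gep * fp + var Gem * fm))
        - qp q * (qp q * ((var Gep * var y - qm q * (var y * var Gep)) * W))
        - qm q * ((var Gep * var x - qp q * (var x * var Gep)) * fp)
        - qm q * ((var Gem * var x - qp q * (var x * var Gem)) * fm)"
      have "?z \<in> rel_ideal q"
        by (blast intro: rel_ideal_intros W_in x_in y_in)
      moreover have "dfree q (Poly_Mapping.single (x # w) 1) - (var Gep * P + var Gem * M) = ?z"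
        unfolding d P_def M_def using y by (auto simp: q_simps q)
      ultimately show ?thesis
        using \<open>P \<in> _\<close> \<open>M \<in> _\<close> by metis
    qed
    have bd: ?case
      if x: "x \<in> {Gb, Gd}" and y: "(x, y) \<in> {(Gb, Ga), (Gd, Gc)}" for y
    proof -
      define P where "P = qp q * (var x * fp)"
      define M where "M = qm q * (var y * W) + qp q * (var x * fm)"
      have "P \<in> homog_poly (word_grade (x # w) - 2)" "M \<in> homog_poly (word_grade (x # w) + 2)"
        unfolding P_def M_def using x y homog(1,2) homog(3)[of y]
        by (auto intro!: homog_poly_add qp_homog simp: algebra_simps)
      have y_in: "var Gem * var y - qp q * (var y * var Gem) \<in> rel_ideal q"
        and x_in: "var Gep * var x - qm q * (var x * var Gep) \<in> rel_ideal q"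
          "var Gem * var x - qm q * (var x * var Gem) \<in> rel_ideal q"
        using x y letter_in_rel_ideal[OF q] by auto
      let ?z = "var x * (dfree q W - (var Gep * fp + var Gem * fm))
        - qm q * ((var Gem * var y - qp q * (var y * var Gem)) * W)
        - qp q * ((var Gep * var x - qm q * (var x * var Gep)) * fp)
        - qp q * ((var Gem * var x - qm q * (var x * var Gem)) * fm)"
      have "?z \<in> rel_ideal q"
        by (blast intro: rel_ideal_intros W_in x_in y_in)
      moreover have "dfree q (Poly_Mapping.single (x # w) 1) - (var Gep * P + var Gem * M) = ?z"
        unfolding d P_def M_def using y by (auto simp: q_simps q)
      ultimately show ?thesis
        using \<open>P \<in> _\<close> \<open>M \<in> _\<close> by metis
    qed
    show ?case
      using x ac[of Gb] ac[of Gd] bd[of Ga] bd[of Gc] by (cases x) simp_all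
  qed
  then obtain fp fm where fp: "fp \<in> homog_poly (g - 2)" "fm \<in> homog_poly (g + 2)"
    and "dfree q (Poly_Mapping.single w 1) - (var Gep * fp + var Gem * fm) \<in> rel_ideal q"
    unfolding w(2) by blast
  then have "scalar k * (dfree q (Poly_Mapping.single w 1) - (var Gep * fp + var Gem * fm)) \<in> rel_ideal q"
    by (intro rel_ideal_mult_left)
  also have "scalar k * (dfree q (Poly_Mapping.single w 1) - (var Gep * fp + var Gem * fm)) =
      dfree q (Poly_Mapping.single w k) - (var Gep * (scalar k * fp) + var Gem * (scalar k * fm))"
    unfolding single_conv_scalar[of w k] dfree_scalar
    by (simp add: algebra_simps scalar_left_commute[of "var x" for x])
  finally show ?case
    using fp by (meson homog_poly_scalar_mult)
qed

text \<open>The square of the differential acts on a word \<open>w\<close> as left multiplication by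
  \<open>d_square_coeff q w\<close> times \<open>e\<^sup>+ e\<^sup>-\<close>.  The recursion reflects that \<open>d\<^sup>2\<close> is an ordinary derivation, with
  \<open>d\<^sup>2 a = - q e\<^sup>+ e\<^sup>- a\<close> and \<open>d\<^sup>2 b = q\<^sup>3 e\<^sup>+ e\<^sup>- b\<close> (and likewise for \<open>c\<close> and \<open>d\<close>), and that a
  generator of grade \<open>g\<close> passes \<open>e\<^sup>+ e\<^sup>-\<close> at the cost of \<open>q\<^sup>-\<^sup>2\<^sup>g\<close>.\<close>

fun d_square_coeff :: "real \<Rightarrow> gen list \<Rightarrow> real" where
  "d_square_coeff q [] = 0"
| "d_square_coeff q (x # w) =
     (if x \<in> {Ga, Gc} then - q + d_square_coeff q w / q\<^sup>2 else q ^ 3 + q\<^sup>2 * d_square_coeff q w)"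

text \<open>The coefficient depends on the grade alone: it is a multiple of a \<open>q\<close>-integer, which
  degenerates to a multiple of the grade when \<open>q\<^sup>2 = 1\<close>.  In particular it vanishes in grade zero.\<close>

lemma d_square_coeff_grade:
  assumes q: "q \<noteq> 0" and "word_degree w = 0"
  shows "(q\<^sup>2 - 1) * d_square_coeff q w = q ^ 3 * (q powi (- 2 * word_grade w) - 1)"
    and "q\<^sup>2 = 1 \<Longrightarrow> d_square_coeff q w = - q * word_grade w"
  using assms(2)
proof (induction w)
  case (Cons x w)
  have p: "q powi (- 2 * (n + m)) = q powi (- 2 * n) * q powi (- 2 * m)" for n m
    using q power_int_add[of q "- 2 * n" "- 2 * m"] by (simp add: algebra_simps)
  have t: "q powi -2 = 1 / q\<^sup>2" "q powi 2 = q\<^sup>2"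
    by (simp_all add: power_int_minus field_simps)
  {
    case 1
    have grade: "q powi (- 2 * word_grade (x # w)) =
        q powi (- 2 * gen_grade x) * q powi (- 2 * word_grade w)"
      unfolding word_grade_simps by (rule p)
    show ?case
    proof (cases "x \<in> {Ga, Gc}")
      case True
      have "(q\<^sup>2 - 1) * d_square_coeff q (x # w) =
          - q * (q\<^sup>2 - 1) + (q\<^sup>2 - 1) * d_square_coeff q w / q\<^sup>2"
        using True by (auto simp: algebra_simps)
      also have "\<dots> = - q * (q\<^sup>2 - 1) + q ^ 3 * (q powi (- 2 * word_grade w) - 1) / q\<^sup>2"
        using Cons(1) 1 by (simp split: if_splits)
      also have "\<dots> = q ^ 3 * (1 / q\<^sup>2 * q powi (- 2 * word_grade w) - 1)"
        using q by (simp add: power2_eq_square power3_eq_cube divide_simps) (simp add: algebra_simps)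
      also have "1 / q\<^sup>2 * q powi (- 2 * word_grade w) = q powi (- 2 * word_grade (x # w))"
        using True grade by (auto simp: t)
      finally show ?thesis .
    next
      case False
      have "(q\<^sup>2 - 1) * d_square_coeff q (x # w) =
          q ^ 3 * (q\<^sup>2 - 1) + q\<^sup>2 * ((q\<^sup>2 - 1) * d_square_coeff q w)"
        using False by (simp add: algebra_simps)
      also have "\<dots> = q ^ 3 * (q\<^sup>2 - 1) + q\<^sup>2 * (q ^ 3 * (q powi (- 2 * word_grade w) - 1))"
        using Cons(1) 1 by (simp split: if_splits)
      also have "\<dots> = q ^ 3 * (q\<^sup>2 * q powi (- 2 * word_grade w) - 1)"
        by (simp add: algebra_simps)
      also have "q\<^sup>2 * q powi (- 2 * word_grade w) = q powi (- 2 * word_grade (x # w))"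
        using False 1 grade by (cases x) (simp_all add: t)
      finally show ?thesis .
    qed
  next
    case 2
    have "q ^ 3 = q"
      using 2(1) by (simp add: power3_eq_cube power2_eq_square)
    then show ?case
      using Cons(2) 2 q by (cases x) (simp_all add: field_simps)
  }
qed simp_all

corollary d_square_coeff_grade_0:
  assumes "q \<noteq> 0" "word_degree w = 0" "word_grade w = 0"
  shows "d_square_coeff q w = 0"
  using d_square_coeff_grade[OF assms(1,2)] assms(3) by (cases "q\<^sup>2 = 1") auto

lemma dfree_square_word:
  assumes q: "q \<noteq> 0" and "word_degree w = 0"
  shows "dfree q (dfree q (Poly_Mapping.single w 1))
    - scalar (complex_of_real (d_square_coeff q w)) * (var Gep * (var Gem * Poly_Mapping.single w 1))
    \<in> rel_ideal q"
  using assms(2)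
proof (induction w)
  case (Cons x w)
  define W :: free_alg where "W = Poly_Mapping.single w 1"
  define S where "S = scalar (complex_of_real (d_square_coeff q w))"
  have x: "x \<notin> {Gep, Gem}" and w: "word_degree w = 0"
    using Cons.prems by (auto split: if_splits)
  note W_in = Cons.IH[OF w, folded W_def S_def]
  have S: "var y * (S * p) = S * (var y * p)" "qp q * (S * p) = S * (qp q * p)"
      "qm q * (S * p) = S * (qm q * p)" for y p
    unfolding S_def by (rule scalar_left_commute)+
  have d_deg: "d_gen q x \<in> degree_poly 1"
    using x
    by (cases x) (simp_all add: degree_poly_def qp_def scalar_def var_def mult_single plus_list_def)
  have "dfree q (dfree q (var x * W)) = dfree q (d_gen q x) * W + var x * dfree q (dfree q W)"
    using x by (simp add: dfree_var_mult dfree_add dfree_mult[OF d_deg])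
  then have d: "dfree q (dfree q (Poly_Mapping.single (x # w) 1)) =
      dfree q (d_gen q x) * W + var x * dfree q (dfree q W)"
    by (simp add: W_def var_mult_single)
  show ?case
  proof (cases "x \<in> {Ga, Gc}")
    case True
    then have l: "var Gep * var x - qp q * (var x * var Gep) \<in> rel_ideal q"
      "var Gem * var x - qp q * (var x * var Gem) \<in> rel_ideal q"
      using letter_in_rel_ideal[OF q] by auto
    let ?Z = "(var Gep * (var Gem * var x - qp q * (var x * var Gem))
      + qp q * ((var Gep * var x - qp q * (var x * var Gep)) * var Gem)) * W"
    let ?z = "var x * (dfree q (dfree q W) - S * (var Gep * (var Gem * W)))
      + qp q * (var x * ((qp q * (qp q * (var Gep * var Gem)) + var Gem * var Gep) * W))
      + qp q * ?Z - S * (qm q * (qm q * ?Z))"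
    have "?z \<in> rel_ideal q"
      by (blast intro: rel_ideal_intros l W_in wedge_in_rel_ideal)
    moreover have "scalar (complex_of_real (d_square_coeff q (x # w))) = - qp q + S * (qm q * qm q)"
      using True by (auto simp: S_def qp_def qm_def scalar_uminus scalar_diff scalar_add divide_inverse power2_eq_square
          simp flip: scalar_mult)
    moreover have "dfree q (dfree q (Poly_Mapping.single (x # w) 1))
        - (- qp q + S * (qm q * qm q)) * (var Gep * (var Gem * (var x * W))) = ?z"
      unfolding d using True by (auto simp: dfree_q dfree_var_mult q_simps q S)
    ultimately show ?thesis
      by (simp add: W_def var_mult_single)
  next
    case False
    then have l: "var Gep * var x - qm q * (var x * var Gep) \<in> rel_ideal q"
      "var Gem * var x - qm q * (var x * var Gem) \<in> rel_ideal q"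
      using x letter_in_rel_ideal[OF q] by (cases x; simp)+
    let ?Z = "(var Gep * (var Gem * var x - qm q * (var x * var Gem))
      + qm q * ((var Gep * var x - qm q * (var x * var Gep)) * var Gem)) * W"
    let ?z = "var x * (dfree q (dfree q W) - S * (var Gep * (var Gem * W)))
      - (qp q * (qp q * (qp q * ?Z)) + S * (qp q * (qp q * ?Z)))"
    have "?z \<in> rel_ideal q"
      by (blast intro: rel_ideal_intros l W_in)
    moreover have "scalar (complex_of_real (d_square_coeff q (x # w)))
        = qp q * (qp q * qp q) + S * (qp q * qp q)"
      using False by (simp add: S_def qp_def power2_eq_square power3_eq_cube scalar_add mult_ac
          flip: scalar_mult)
    moreover have "dfree q (dfree q (Poly_Mapping.single (x # w) 1))
        - (qp q * (qp q * qp q) + S * (qp q * qp q)) * (var Gep * (var Gem * (var x * W))) = ?z"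
      unfolding d using False x by (cases x) (simp_all add: dfree_q dfree_var_mult q_simps q S)
    ultimately show ?thesis
      by (simp add: W_def var_mult_single)
  qed
qed (simp add: single_Nil_one)

text \<open>In general grade the differential does not square to zero; this is where the restriction to the
  sphere enters.\<close>

lemma dfree_square:
  assumes q: "q \<noteq> 0" and p: "p \<in> homog_poly 0"
  shows "dfree q (dfree q p) \<in> rel_ideal q"
proof (induction p rule: free_alg_induct)
  case (single w k)
  then have w: "word_degree w = 0" "word_grade w = 0"
    using p by (auto simp: homog_poly_def)
  then have "dfree q (dfree q (Poly_Mapping.single w 1)) \<in> rel_ideal q"
    using dfree_square_word[OF q w(1)] by (simp add: d_square_coeff_grade_0 q)
  then show ?case
    by (subst single_conv_scalar) (simp add: dfree_scalar rel_ideal_mult_left)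
qed (simp_all add: dfree_add rel_ideal_add)

section \<open>Classes of polynomials\<close>

lemma cls_eq_iff: "cls q p = cls q r \<longleftrightarrow> p - r \<in> rel_ideal q"
proof -
  have shift: "cls q p = {x + p | x. x \<in> rel_ideal q}" for p
    unfolding cls_def a_r_coset_def' by auto
  show ?thesis
  proof
    assume "cls q p = cls q r"
    moreover have "p \<in> cls q p"
      unfolding shift by (rule CollectI) (metis add_0 rel_ideal_zero)
    ultimately obtain x where "p = x + r" "x \<in> rel_ideal q"
      unfolding shift by blast
    then show "p - r \<in> rel_ideal q"
      by simp
  next
    assume *: "p - r \<in> rel_ideal q"
    have "x + p = (x + (p - r)) + r" "x + r = (x - (p - r)) + p" for x
      by simp_all
    with * show "cls q p = cls q r"
      unfolding shift by (blast intro: rel_ideal_add rel_ideal_diff)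
  qed
qed

lemma carrier_Forms: "carrier (Forms q) = range (cls q)"
  unfolding Forms_def FactRing_def A_RCOSETS_defs cls_def a_r_coset_def by auto

lemma cls_in_carrier [simp]: "cls q p \<in> carrier (Forms q)"
  by (simp add: carrier_Forms)

lemma cls_mult [simp]: "cls q p \<otimes>\<^bsub>Forms q\<^esub> cls q r = cls q (p * r)"
  and cls_add [simp]: "cls q p \<oplus>\<^bsub>Forms q\<^esub> cls q r = cls q (p + r)"
  and cls_zero: "\<zero>\<^bsub>Forms q\<^esub> = cls q 0"
  using ring_hom_mult[OF ideal.rcos_ring_hom[OF ideal_rel_ideal], of p r q]
    ring_hom_add[OF ideal.rcos_ring_hom[OF ideal_rel_ideal], of p r q]
    ring_hom_zero[OF ideal.rcos_ring_hom[OF ideal_rel_ideal] ring_Free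
      ideal.quotient_is_ring[OF ideal_rel_ideal], of q]
  by (simp_all add: cls_def Forms_def)

lemma cls_diff [simp]: "cls q p \<ominus>\<^bsub>Forms q\<^esub> cls q r = cls q (p - r)"
proof -
  interpret ring "Forms q"
    unfolding Forms_def by (rule ideal.quotient_is_ring[OF ideal_rel_ideal])
  have "\<ominus>\<^bsub>Forms q\<^esub> cls q r = cls q (- r)"
    by (rule minus_equality) (simp_all add: cls_zero)
  then show ?thesis
    by (simp add: a_minus_def)
qed

lemma smul_cls [simp]: "smul q k (cls q p) = cls q (scalar k * p)"
  by (simp add: smul_def)

section \<open>The differential on forms\<close>

definition d_forms :: "real \<Rightarrow> free_alg set \<Rightarrow> free_alg set" where
  "d_forms q = restrict (\<lambda>x. cls q (dfree q (SOME p. x = cls q p))) (carrier (Forms q))"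

lemma d_forms_cls:
  assumes "q \<noteq> 0"
  shows "d_forms q (cls q p) = cls q (dfree q p)"
proof -
  define r where "r = (SOME r. cls q p = cls q r)"
  have "cls q p = cls q r"
    unfolding r_def by (rule someI) simp
  then have "dfree q (p - r) \<in> rel_ideal q"
    using dfree_rel_ideal[OF assms] cls_eq_iff by blast
  then have "cls q (dfree q p) = cls q (dfree q r)"
    by (simp add: cls_eq_iff dfree_diff)
  then show ?thesis
    by (simp add: d_forms_def r_def)
qed

lemma scalar_sign: "scalar ((- 1) ^ n) = (- 1) ^ n"
  by (cases "even n") (simp_all add: scalar_uminus)

lemma is_differential_d_forms:
  assumes "q \<noteq> 0"
  shows "is_differential q (d_forms q)"
  unfolding is_differential_def
proof (intro conjI ballI allI)
  show "d_forms q \<in> carrier (Forms q) \<rightarrow>\<^sub>E carrier (Forms q)"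
    unfolding d_forms_def by auto
  fix n x y
  assume "x \<in> form_degree q n" "y \<in> carrier (Forms q)"
  then obtain p r where "x = cls q p" "p \<in> degree_poly n" "y = cls q r"
    unfolding form_degree_def carrier_Forms degree_poly_def by blast
  then show "d_forms q (x \<otimes>\<^bsub>Forms q\<^esub> y) = d_forms q x \<otimes>\<^bsub>Forms q\<^esub> y
      \<oplus>\<^bsub>Forms q\<^esub> smul q ((- 1) ^ n) (x \<otimes>\<^bsub>Forms q\<^esub> d_forms q y)"
    by (simp add: d_forms_cls[OF assms] dfree_mult scalar_sign)
qed (auto simp: carrier_Forms d_forms_cls[OF assms] dfree_add dfree_scalar qp_def cls_zero)

lemma is_differential_unique:
  assumes q: "q \<noteq> 0" and D: "is_differential q D"
  shows "D = d_forms q"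
proof -
  have D_add: "D (cls q (p + r)) = D (cls q p) \<oplus>\<^bsub>Forms q\<^esub> D (cls q r)" for p r
    using D unfolding is_differential_def by (metis cls_add cls_in_carrier)
  have D_smul: "D (cls q (scalar k * p)) = smul q k (D (cls q p))" for k p
    using D unfolding is_differential_def by (metis cls_in_carrier smul_cls)
  have D_mult: "D (cls q (p * r)) = D (cls q p) \<otimes>\<^bsub>Forms q\<^esub> cls q r
      \<oplus>\<^bsub>Forms q\<^esub> smul q ((- 1) ^ n) (cls q p \<otimes>\<^bsub>Forms q\<^esub> D (cls q r))"
    if "p \<in> degree_poly n" for p r n
  proof -
    have "cls q p \<in> form_degree q n"
      using that unfolding form_degree_def degree_poly_def by blast
    then show ?thesis
      using D unfolding is_differential_def by (metis cls_mult cls_in_carrier)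
  qed
  have D_cls: "\<exists>r. D (cls q p) = cls q r" for p
    using D unfolding is_differential_def PiE_def Pi_def carrier_Forms by blast
  have D_var: "D (cls q (var x)) = cls q (dfree q (var x))" for x
    using D unfolding is_differential_def
    by (cases x) (simp_all add: qp_def cls_zero)
  have D_zero: "D (cls q 0) = cls q 0"
    using D_smul[of 0 0] D_cls[of 0] by auto
  \<comment> \<open>This is the Leibniz rule for \<open>1 = 1 * 1\<close>.\<close>
  have D_one: "D (cls q 1) = cls q 0"
  proof -
    obtain r where "D (cls q 1) = cls q r"
      using D_cls by blast
    then show ?thesis
      using D_mult[of 1 0 1] degree_poly_scalar[of 1] by (simp add: cls_eq_iff rel_ideal_uminus)
        (metis rel_ideal_uminus minus_minus)
  qed
  have "D (cls q (Poly_Mapping.single w 1)) = cls q (dfree q (Poly_Mapping.single w 1))" for w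
  proof (induction w)
    case (Cons x w)
    then show ?case
      using D_mult[OF degree_poly_var, of x "Poly_Mapping.single w 1"]
        dfree_mult[OF degree_poly_var, of q x "Poly_Mapping.single w 1"]
      unfolding var_mult_single by (simp add: D_var scalar_sign scalar_uminus)
  qed (simp add: single_Nil_one D_one)
  then have "D (cls q p) = cls q (dfree q p)" for p
  proof (induction p rule: free_alg_induct)
    case (single w k)
    then show ?case
      by (subst (1 2) single_conv_scalar) (simp add: D_smul dfree_scalar)
  qed (simp_all add: D_add D_zero dfree_add)
  then have "D x = d_forms q x" if "x \<in> carrier (Forms q)" for x
    using that by (auto simp: carrier_Forms d_forms_cls[OF q])
  moreover have "D x = d_forms q x" if "x \<notin> carrier (Forms q)" for x
    using D that unfolding is_differential_def by (auto simp: d_forms_def PiE_def extensional_def)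
  ultimately show ?thesis by blast
qed

lemma diff_cls:
  assumes "q \<noteq> 0"
  shows "diff q (cls q p) = cls q (dfree q p)"
proof -
  have "diff q = d_forms q"
    unfolding diff_def
    using is_differential_d_forms[OF assms] is_differential_unique[OF assms] by (rule the_equality)
  then show ?thesis
    by (simp add: d_forms_cls[OF assms])
qed

lemma partials_cls:
  assumes q: "q \<noteq> 0" and deg: "fp \<in> degree_poly 0" "fm \<in> degree_poly 0"
    and p: "dfree q p - (var Gep * fp + var Gem * fm) \<in> rel_ideal q"
  shows "partial_p q (cls q p) = cls q fp" "partial_m q (cls q p) = cls q fm"
proof -
  have "partials q (cls q p) = (cls q fp, cls q fm)"
    unfolding partials_def
  proof (rule the_equality)
    show "case (cls q fp, cls q fm) of (fp, fm) \<Rightarrow> fp \<in> CqSL2 q \<and> fm \<in> CqSL2 q \<and>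
        diff q (cls q p) = elt q Gep \<otimes>\<^bsub>Forms q\<^esub> fp \<oplus>\<^bsub>Forms q\<^esub> elt q Gem \<otimes>\<^bsub>Forms q\<^esub> fm"
      using deg p by (auto simp: CqSL2_def degree_poly_def diff_cls[OF q] cls_eq_iff)
  next
    fix y
    assume "case y of (fp, fm) \<Rightarrow> fp \<in> CqSL2 q \<and> fm \<in> CqSL2 q \<and>
        diff q (cls q p) = elt q Gep \<otimes>\<^bsub>Forms q\<^esub> fp \<oplus>\<^bsub>Forms q\<^esub> elt q Gem \<otimes>\<^bsub>Forms q\<^esub> fm"
    then obtain gp gm where y: "y = (cls q gp, cls q gm)"
      and gdeg: "gp \<in> degree_poly 0" "gm \<in> degree_poly 0"
      and "diff q (cls q p) = elt q Gep \<otimes>\<^bsub>Forms q\<^esub> cls q gp \<oplus>\<^bsub>Forms q\<^esub> elt q Gem \<otimes>\<^bsub>Forms q\<^esub> cls q gm"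
      unfolding CqSL2_def degree_poly_def by (cases y) blast
    then have "dfree q p - (var Gep * gp + var Gem * gm) \<in> rel_ideal q"
      by (simp add: diff_cls[OF q] cls_eq_iff)
    from rel_ideal_diff[OF p this]
    have "0 + (var Gep * (gp - fp) + var Gem * (gm - fm)) + var Gep * var Gem * 0 \<in> rel_ideal q"
      by (simp add: algebra_simps)
    from forms_independent(2,3)[OF q _ _ _ _ this] deg gdeg
    show "y = (cls q fp, cls q fm)"
      by (simp add: y cls_eq_iff degree_poly_diff)
  qed
  then show "partial_p q (cls q p) = cls q fp" "partial_m q (cls q p) = cls q fm"
    by (simp_all add: partial_p_def partial_m_def)
qed

lemma wedge_commute:
  assumes q: "q \<noteq> 0" and h: "h \<in> homog_poly 0"
  shows "var Gep * var Gem * h - h * var Gep * var Gem \<in> rel_ideal q"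
proof -
  have "var Gep * (var Gem * h - h * var Gem) + (var Gep * h - h * var Gep) * var Gem \<in> rel_ideal q"
    using commute_in_rel_ideal[of Gep h 0 q] commute_in_rel_ideal[of Gem h 0 q] h
    by (simp add: rel_ideal_intros)
  then show ?thesis
    by (simp add: algebra_simps)
qed

text \<open>By freeness a form determines its components modulo the relations, so the description that
  defines \<open>\<delta>\<close> has a single solution.\<close>

lemma delta_cls:
  assumes q: "q \<noteq> 0"
    and f: "f \<in> homog_poly 0" and fp: "fp \<in> homog_poly (- 2)" and fm: "fm \<in> homog_poly 2"
    and h: "h \<in> homog_poly 0"
  shows "delta q \<alpha> \<beta> \<gamma> \<epsilon> (cls q (f + (var Gep * fp + var Gem * fm) + h * (var Gep * var Gem))) =
    (rsmul q (\<alpha> * q powi (-2)) (partial_m q (cls q fp))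
        \<oplus>\<^bsub>Forms q\<^esub> rsmul q (\<beta> * q\<^sup>2) (partial_p q (cls q fm)))
      \<oplus>\<^bsub>Forms q\<^esub>
     (rsmul q (\<alpha> * \<gamma> * q powi (-4)) (elt q Gem \<otimes>\<^bsub>Forms q\<^esub> partial_m q (cls q h))
        \<ominus>\<^bsub>Forms q\<^esub> rsmul q (\<beta> * \<epsilon> * q ^ 4) (elt q Gep \<otimes>\<^bsub>Forms q\<^esub> partial_p q (cls q h)))"
  (is "delta q \<alpha> \<beta> \<gamma> \<epsilon> ?w = ?R (cls q fp) (cls q fm) (cls q h)")
proof -
  have unique: "cls q f' = cls q f \<and> cls q fp' = cls q fp \<and> cls q fm' = cls q fm \<and> cls q h' = cls q h"
    if "f' \<in> homog_poly 0" "fp' \<in> homog_poly (- 2)" "fm' \<in> homog_poly 2" "h' \<in> homog_poly 0"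
      and w: "?w = cls q (f' + (var Gep * fp' + var Gem * fm') + h' * (var Gep * var Gem))"
    for f' fp' fm' h'
  proof -
    have "f + (var Gep * fp + var Gem * fm) + h * (var Gep * var Gem)
        - (f' + (var Gep * fp' + var Gem * fm') + h' * (var Gep * var Gem)) \<in> rel_ideal q"
      using w by (simp add: cls_eq_iff)
    from rel_ideal_add[OF this wedge_commute[OF q homog_poly_diff[OF h that(4)]]]
    have *: "(f - f') + (var Gep * (fp - fp') + var Gem * (fm - fm')) + var Gep * var Gem * (h - h')
        \<in> rel_ideal q"
      by (simp add: algebra_simps)
    have "f - f' \<in> degree_poly 0" "fp - fp' \<in> degree_poly 0" "fm - fm' \<in> degree_poly 0"
      "h - h' \<in> degree_poly 0"
      using f fp fm h that homog_poly_degree degree_poly_diff by blast+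
    from forms_independent[OF q this *] show ?thesis
      by (metis cls_eq_iff)
  qed
  show ?thesis
    unfolding delta_def
  proof (rule the_equality, goal_cases)
    case 1
    show ?case
      unfolding S2_def CqSL2_grade_def bex_simps
      by (rule bexI[OF _ f], rule bexI[OF _ fp], rule bexI[OF _ fm], rule bexI[OF _ h])
        (simp add: ep_wedge_em_def)
  next
    case (2 \<eta>)
    then obtain f' fp' fm' h' where
      "f' \<in> homog_poly 0" "fp' \<in> homog_poly (- 2)" "fm' \<in> homog_poly 2" "h' \<in> homog_poly 0"
      and "?w = cls q (f' + (var Gep * fp' + var Gem * fm') + h' * (var Gep * var Gem))"
      and "\<eta> = ?R (cls q fp') (cls q fm') (cls q h')"
      unfolding S2_def CqSL2_grade_def bex_simps by (auto simp: ep_wedge_em_def)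
    then show ?case
      using unique by simp
  qed
qed

section \<open>The Laplacian\<close>

text \<open>The common function is \<open>g = (\<alpha> + \<beta> q\<^sup>2) \<partial>\<^sub>+ \<partial>\<^sub>- f\<close>.  In the proof \<open>P = \<partial>\<^sub>+ f\<close> and
  \<open>M = \<partial>\<^sub>- f\<close>, and a second letter in front is a second derivative: \<open>MP = \<partial>\<^sub>- \<partial>\<^sub>+ f\<close> and
  \<open>PM = \<partial>\<^sub>+ \<partial>\<^sub>- f\<close>.\<close>

lemma laplacian_functions_and_2_forms:
  fixes q \<alpha> \<beta> \<gamma> \<epsilon> :: real
  assumes q: "q \<noteq> 0" and \<gamma>: "\<gamma> = q\<^sup>2" and \<epsilon>: "\<epsilon> = q powi (-4)" and f: "f \<in> homog_poly 0"
  shows "\<exists>g\<in>homog_poly 0. Laplacian q \<alpha> \<beta> \<gamma> \<epsilon> (cls q f) = cls q g \<and>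
    Laplacian q \<alpha> \<beta> \<gamma> \<epsilon> (cls q (f * (var Gep * var Gem))) = cls q (g * (var Gep * var Gem))"
proof -
  obtain P M where P: "P \<in> homog_poly (- 2)" and M: "M \<in> homog_poly 2"
    and df: "dfree q f - (var Gep * P + var Gem * M) \<in> rel_ideal q"
    using dfree_decomposition[OF q f] by auto
  obtain PP MP where PP: "PP \<in> homog_poly (- 4)" and MP: "MP \<in> homog_poly 0"
    and dP: "dfree q P - (var Gep * PP + var Gem * MP) \<in> rel_ideal q"
    using dfree_decomposition[OF q P] by auto
  obtain PM MM where PM: "PM \<in> homog_poly 0" and MM: "MM \<in> homog_poly 4"
    and dM: "dfree q M - (var Gep * PM + var Gem * MM) \<in> rel_ideal q"
    using dfree_decomposition[OF q M] by auto
  note partials = partials_cls[OF q homog_poly_degree[OF P] homog_poly_degree[OF M] df]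
    partials_cls[OF q homog_poly_degree[OF PP] homog_poly_degree[OF MP] dP]
    partials_cls[OF q homog_poly_degree[OF PM] homog_poly_degree[OF MM] dM]
  have partials_0: "partial_p q (cls q 0) = cls q 0" "partial_m q (cls q 0) = cls q 0"
    using partials_cls[OF q, of 0 0 0] by simp_all
  have ep: "dfree q (var Gep * P) + var Gep * var Gem * MP \<in> rel_ideal q"
  proof -
    have "- (var Gep * (dfree q P - (var Gep * PP + var Gem * MP)))
        - (var Gep * var Gep) * PP \<in> rel_ideal q"
      by (blast intro: rel_ideal_intros dP wedge_in_rel_ideal)
    then show ?thesis
      by (simp add: dfree_var_mult algebra_simps)
  qed
  have em: "dfree q (var Gem * M) - qp q * (qp q * (var Gep * var Gem * PM)) \<in> rel_ideal q"
  proof -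
    have "- (var Gem * (dfree q M - (var Gep * PM + var Gem * MM)))
        - (qp q * (qp q * (var Gep * var Gem)) + var Gem * var Gep) * PM
        - (var Gem * var Gem) * MM \<in> rel_ideal q"
      by (blast intro: rel_ideal_intros dM wedge_in_rel_ideal)
    then show ?thesis
      by (simp add: dfree_var_mult q_simps q)
  qed
  \<comment> \<open>The coefficient of \<open>e\<^sup>+ e\<^sup>-\<close> in \<open>d\<^sup>2 f = 0\<close> compares the mixed second derivatives.\<close>
  have mixed: "qp q * (qp q * PM) - MP \<in> rel_ideal q"
  proof -
    have "dfree q (dfree q f) - dfree q (dfree q f - (var Gep * P + var Gem * M))
        + (dfree q (var Gep * P) + var Gep * var Gem * MP) * (- 1)
        - (dfree q (var Gem * M) - qp q * (qp q * (var Gep * var Gem * PM))) \<in> rel_ideal q"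
      by (intro rel_ideal_add rel_ideal_diff rel_ideal_mult_right ep em dfree_square[OF q f]
          dfree_rel_ideal[OF q df])
    then have "0 + (var Gep * 0 + var Gem * 0) + var Gep * var Gem * (qp q * (qp q * PM) - MP) \<in> rel_ideal q"
      by (simp add: dfree_diff dfree_add q_simps q)
    moreover have "qp q * (qp q * PM) - MP \<in> degree_poly 0"
      unfolding qp_def
      by (rule homog_poly_degree, rule homog_poly_diff[OF _ MP]) (intro homog_poly_scalar_mult PM)
    ultimately show ?thesis
      using forms_independent(4)[OF q, of 0 0 0] by simp
  qed
  define g where "g = scalar (complex_of_real (\<alpha> + \<beta> * q\<^sup>2)) * PM"
  have g: "g \<in> homog_poly 0"
    unfolding g_def by (rule homog_poly_scalar_mult[OF PM])
  \<comment> \<open>The values of \<open>\<gamma>\<close> and \<open>\<epsilon>\<close> enter through these two identities.\<close>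
  have coeff: "\<gamma> * q powi (-4) = q powi (-2)" "\<epsilon> * q ^ 4 = 1"
    using q by (simp_all add: \<gamma> \<epsilon> power_int_minus field_simps power2_eq_square power4_eq_xxxx)
  let ?s = "\<lambda>k. scalar (complex_of_real k)"
  have coeff_q: "?s (\<alpha> * q powi (-2)) * (qp q * (qp q * x)) = ?s \<alpha> * x" for x
  proof -
    have "?s (\<alpha> * q powi (-2)) * (qp q * qp q) = ?s \<alpha>"
      using q by (simp add: qp_def power_int_minus field_simps power2_eq_square flip: scalar_mult)
    then have "?s (\<alpha> * q powi (-2)) * (qp q * qp q) * x = ?s \<alpha> * x"
      by (simp only:)
    then show ?thesis
      by (simp only: mult.assoc)
  qed
  have g_eq: "g = ?s \<alpha> * PM + ?s \<beta> * (qp q * (qp q * PM))"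
    by (simp add: g_def qp_def scalar_add scalar_mult power2_eq_square algebra_simps)
  have delta_0: "delta q \<alpha> \<beta> \<gamma> \<epsilon> (cls q 0) = cls q 0"
    using delta_cls[OF q, of 0 0 0 0 \<alpha> \<beta> \<gamma> \<epsilon>] by (simp add: partials_0)
  have diff_0: "diff q (cls q 0) = cls q 0"
    by (simp add: diff_cls[OF q])
  have "Laplacian q \<alpha> \<beta> \<gamma> \<epsilon> (cls q f) = cls q g"
  proof -
    have "diff q (cls q f) = cls q (0 + (var Gep * P + var Gem * M) + 0 * (var Gep * var Gem))"
      using df by (simp add: diff_cls[OF q] cls_eq_iff)
    then have "delta q \<alpha> \<beta> \<gamma> \<epsilon> (diff q (cls q f)) =
        cls q (?s (\<alpha> * q powi (-2)) * MP + ?s (\<beta> * q\<^sup>2) * PM)"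
      using delta_cls[OF q homog_poly_zero P M homog_poly_zero, of \<alpha> \<beta> \<gamma> \<epsilon>]
      by (simp add: partials partials_0)
    moreover have "delta q \<alpha> \<beta> \<gamma> \<epsilon> (cls q f) = cls q 0"
      using delta_cls[OF q f homog_poly_zero homog_poly_zero homog_poly_zero, of \<alpha> \<beta> \<gamma> \<epsilon>]
      by (simp add: partials_0)
    moreover have "?s (\<alpha> * q powi (-2)) * MP + ?s (\<beta> * q\<^sup>2) * PM - g \<in> rel_ideal q"
    proof -
      have "- (?s (\<alpha> * q powi (-2)) * (qp q * (qp q * PM) - MP)) \<in> rel_ideal q"
        by (intro rel_ideal_uminus rel_ideal_mult_left mixed)
      then show ?thesis
        using coeff_q[of PM] unfolding g_def by (simp add: algebra_simps scalar_add del: of_real_power_int of_real_mult)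
    qed
    ultimately show ?thesis
      by (simp add: Laplacian_def diff_0 cls_eq_iff)
  qed
  moreover have "Laplacian q \<alpha> \<beta> \<gamma> \<epsilon> (cls q (f * (var Gep * var Gem))) = cls q (g * (var Gep * var Gem))"
  proof -
    have "dfree q (f * (var Gep * var Gem)) \<in> rel_ideal q"
    proof -
      let ?e = "var Gep" and ?f = "var Gem"
      \<comment> \<open>Moving \<open>e\<^sup>\<plusminus>\<close> past \<open>P\<close> and \<open>M\<close> creates products of three one-forms, which vanish.\<close>
      let ?z = "(dfree q f - (?e * P + ?f * M)) * (?e * ?f)
        + (?e * P - ?s (q powi (-2)) * P * ?e) * (?e * ?f) + ?s (q powi (-2)) * P * ((?e * ?e) * ?f)
        + (?f * M - ?s (q powi 2) * M * ?f) * (?e * ?f)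
        + ?s (q powi 2) * M * ((qp q * (qp q * (?e * ?f)) + ?f * ?e) * ?f)
        - ?s (q powi 2) * M * (qp q * (qp q * (?e * (?f * ?f))))"
      have "?z \<in> rel_ideal q"
        by (blast intro: rel_ideal_intros df wedge_in_rel_ideal
            commute_in_rel_ideal[OF insertI1 P] commute_in_rel_ideal[OF insertI2[OF singletonI] M])
      moreover have "dfree q (f * (var Gep * var Gem)) = ?z"
        using dfree_mult[OF homog_poly_degree[OF f]]
        by (simp add: dfree_var_mult algebra_simps)
      ultimately show ?thesis by simp
    qed
    then have diff_f: "diff q (cls q (f * (var Gep * var Gem))) = cls q 0"
      by (simp add: diff_cls[OF q] cls_eq_iff)
    have delta_f: "delta q \<alpha> \<beta> \<gamma> \<epsilon> (cls q (f * (var Gep * var Gem))) =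
        cls q (?s (\<alpha> * q powi (-2)) * (var Gem * M) - ?s \<beta> * (var Gep * P))"
      using delta_cls[OF q homog_poly_zero homog_poly_zero homog_poly_zero f, of \<alpha> \<beta> \<gamma> \<epsilon>] coeff
      by (simp add: partials partials_0 mult.assoc del: of_real_power_int of_real_mult)
    have diff_delta_f: "dfree q (?s (\<alpha> * q powi (-2)) * (var Gem * M) - ?s \<beta> * (var Gep * P))
        - g * (var Gep * var Gem) \<in> rel_ideal q"
    proof -
      have "?s (\<alpha> * q powi (-2)) * (dfree q (var Gem * M) - qp q * (qp q * (var Gep * var Gem * PM)))
        - ?s \<beta> * (dfree q (var Gep * P) + var Gep * var Gem * MP)
        - ?s \<beta> * (var Gep * var Gem * (qp q * (qp q * PM) - MP))
        + (var Gep * var Gem * g - g * var Gep * var Gem) \<in> rel_ideal q"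
        by (intro rel_ideal_add rel_ideal_diff rel_ideal_mult_left em ep mixed wedge_commute[OF q g])
      moreover note coeff_q
      moreover have "var Gep * var Gem * g =
          ?s \<alpha> * (var Gep * var Gem * PM) + ?s \<beta> * (var Gep * var Gem * (qp q * (qp q * PM)))"
        unfolding g_eq by (simp add: distrib_left scalar_left_commute[of "var Gep * var Gem"])
      ultimately show ?thesis
        unfolding dfree_diff dfree_scalar
        by (simp add: algebra_simps del: of_real_power_int of_real_mult)
    qed
    show ?thesis
      unfolding Laplacian_def diff_f delta_0 delta_f
      unfolding diff_cls[OF q] cls_add add_0 cls_eq_iff
      by (rule diff_delta_f)
  qed
  ultimately show ?thesis
    using g by blast
qed

lemma wedge_cancel:
  assumes q: "q \<noteq> 0" and p: "p \<in> homog_poly 0"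
  shows "p * (var Gep * var Gem) \<in> rel_ideal q \<longleftrightarrow> p \<in> rel_ideal q"
proof
  assume "p * (var Gep * var Gem) \<in> rel_ideal q"
  from rel_ideal_add[OF this wedge_commute[OF q p]]
  have "0 + (var Gep * 0 + var Gem * 0) + var Gep * var Gem * p \<in> rel_ideal q"
    by (simp add: mult.assoc)
  from forms_independent(4)[OF q _ _ _ _ this] show "p \<in> rel_ideal q"
    using homog_poly_degree[OF p] by simp
qed (rule rel_ideal_mult_right)

theorem theorem11p3:
  fixes q \<alpha> \<beta> \<gamma> \<epsilon> :: real
  assumes "q \<noteq> 0" and "\<gamma> = q\<^sup>2" and "\<epsilon> = q powi (-4)"
  shows "(\<forall>f \<in> S2 q.
            Laplacian q \<alpha> \<beta> \<gamma> \<epsilon> (f \<otimes>\<^bsub>Forms q\<^esub> ep_wedge_em q) =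
              Laplacian q \<alpha> \<beta> \<gamma> \<epsilon> f \<otimes>\<^bsub>Forms q\<^esub> ep_wedge_em q)
       \<and> eigenvalues q (Laplacian q \<alpha> \<beta> \<gamma> \<epsilon>) (Omega2_S2 q) =
           eigenvalues q (Laplacian q \<alpha> \<beta> \<gamma> \<epsilon>) (S2 q)
       \<and> (\<forall>k. eigenforms q (Laplacian q \<alpha> \<beta> \<gamma> \<epsilon>) (Omega2_S2 q) k =
             (\<lambda>f. ep_wedge_em q \<otimes>\<^bsub>Forms q\<^esub> f) ` eigenforms q (Laplacian q \<alpha> \<beta> \<gamma> \<epsilon>) (S2 q) k)"
proof -
  let ?L = "Laplacian q \<alpha> \<beta> \<gamma> \<epsilon>"
  note q = assms(1)
  have ee: "ep_wedge_em q = cls q (var Gep * var Gem)"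
    by (simp add: ep_wedge_em_def)
  have S2: "S2 q = cls q ` homog_poly 0"
    by (simp add: S2_def CqSL2_grade_def)
  have commute: "ep_wedge_em q \<otimes>\<^bsub>Forms q\<^esub> x = x \<otimes>\<^bsub>Forms q\<^esub> ep_wedge_em q" if x: "x \<in> S2 q" for x
  proof -
    obtain p where "x = cls q p" and p: "p \<in> homog_poly 0"
      using x unfolding S2 by blast
    then show ?thesis
      using wedge_commute[OF q p] by (simp add: ee cls_eq_iff mult.assoc)
  qed
  have L_mult: "?L (x \<otimes>\<^bsub>Forms q\<^esub> ep_wedge_em q) = ?L x \<otimes>\<^bsub>Forms q\<^esub> ep_wedge_em q"
    and L_closed: "?L x \<in> S2 q" if x: "x \<in> S2 q" for x
  proof -
    obtain p where p: "x = cls q p" "p \<in> homog_poly 0"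
      using x unfolding S2 by blast
    from laplacian_functions_and_2_forms[OF assms p(2)] obtain g where "g \<in> homog_poly 0"
      "?L (cls q p) = cls q g" "?L (cls q (p * (var Gep * var Gem))) = cls q (g * (var Gep * var Gem))"
      by blast
    then show "?L (x \<otimes>\<^bsub>Forms q\<^esub> ep_wedge_em q) = ?L x \<otimes>\<^bsub>Forms q\<^esub> ep_wedge_em q" "?L x \<in> S2 q"
      by (simp_all add: p ee S2)
  qed
  have smul: "smul q k (x \<otimes>\<^bsub>Forms q\<^esub> ep_wedge_em q) = smul q k x \<otimes>\<^bsub>Forms q\<^esub> ep_wedge_em q"
    and smul_closed: "smul q k x \<in> S2 q" if "x \<in> S2 q" for k x
    using that by (auto simp: S2 ee mult.assoc homog_poly_scalar_mult)
  have cancel: "x \<otimes>\<^bsub>Forms q\<^esub> ep_wedge_em q = y \<otimes>\<^bsub>Forms q\<^esub> ep_wedge_em q \<longleftrightarrow> x = y"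
    if x: "x \<in> S2 q" and y: "y \<in> S2 q" for x y
  proof -
    obtain p r where "x = cls q p" "y = cls q r" and p: "p \<in> homog_poly 0" "r \<in> homog_poly 0"
      using x y unfolding S2 by blast
    then show ?thesis
      using wedge_cancel[OF q homog_poly_diff[OF p]] by (simp add: ee cls_eq_iff left_diff_distrib)
  qed
  have "\<zero>\<^bsub>Forms q\<^esub> \<in> S2 q" and "\<zero>\<^bsub>Forms q\<^esub> \<otimes>\<^bsub>Forms q\<^esub> ep_wedge_em q = \<zero>\<^bsub>Forms q\<^esub>"
    by (auto simp: S2 cls_zero ee)
  then have nonzero: "x \<otimes>\<^bsub>Forms q\<^esub> ep_wedge_em q = \<zero>\<^bsub>Forms q\<^esub> \<longleftrightarrow> x = \<zero>\<^bsub>Forms q\<^esub>" if "x \<in> S2 q" for x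
    using cancel[OF that] by metis
  have eigenforms: "eigenforms q ?L (Omega2_S2 q) k =
      (\<lambda>f. ep_wedge_em q \<otimes>\<^bsub>Forms q\<^esub> f) ` eigenforms q ?L (S2 q) k" for k
  proof -
    have "?L (x \<otimes>\<^bsub>Forms q\<^esub> ep_wedge_em q) = smul q k (x \<otimes>\<^bsub>Forms q\<^esub> ep_wedge_em q) \<longleftrightarrow> ?L x = smul q k x"
      if "x \<in> S2 q" for x
      using that by (simp add: L_mult smul cancel L_closed smul_closed)
    with nonzero have iff: "x \<in> S2 q \<and> x \<otimes>\<^bsub>Forms q\<^esub> ep_wedge_em q \<noteq> \<zero>\<^bsub>Forms q\<^esub> \<and>
          ?L (x \<otimes>\<^bsub>Forms q\<^esub> ep_wedge_em q) = smul q k (x \<otimes>\<^bsub>Forms q\<^esub> ep_wedge_em q) \<longleftrightarrow>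
        x \<in> eigenforms q ?L (S2 q) k" for x
      by (simp add: eigenforms_def cong: conj_cong)
    have "eigenforms q ?L (Omega2_S2 q) k = {x \<otimes>\<^bsub>Forms q\<^esub> ep_wedge_em q | x.
        x \<in> S2 q \<and> x \<otimes>\<^bsub>Forms q\<^esub> ep_wedge_em q \<noteq> \<zero>\<^bsub>Forms q\<^esub> \<and>
          ?L (x \<otimes>\<^bsub>Forms q\<^esub> ep_wedge_em q) = smul q k (x \<otimes>\<^bsub>Forms q\<^esub> ep_wedge_em q)}"
      unfolding eigenforms_def Omega2_S2_def by blast
    also have "\<dots> = (\<lambda>f. f \<otimes>\<^bsub>Forms q\<^esub> ep_wedge_em q) ` eigenforms q ?L (S2 q) k"
      unfolding iff by blast
    also have "\<dots> = (\<lambda>f. ep_wedge_em q \<otimes>\<^bsub>Forms q\<^esub> f) ` eigenforms q ?L (S2 q) k"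
      by (rule image_cong) (simp_all add: eigenforms_def commute)
    finally show ?thesis .
  qed
  then show ?thesis
    using L_mult by (simp add: eigenvalues_def)
qed

end
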